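(* Let $p \in [1,\infty)\cup\{\infty\}$. There is an algorithm which, given $d\in\mathbb{N}$, $\epsilon>0$, $\lambda\in[0,1)$ and black-box query access to a function $f:[0,1]^d\to[0,1]^d$ that is $\lambda$-contracting with respect to the $\ell_p$-norm, finds an $\epsilon$-approximate fixpoint of $f$ using $\mathcal{O}\!\left(d^2\left(\log\frac{1}{\epsilon}+\log\frac{1}{1-\lambda}\right)\right)$ queries to $f$.
   Context: For $x\in\mathbb{R}^d$, $\|x\|_p=(\sum_i |x_i|^p)^{1/p}$ for $p<\infty$ and $\|x\|_\infty=\max_i|x_i|$. A map $f:[0,1]^d\to[0,1]^d$ is $\lambda$-contracting (w.r.t. $\ell_p$) if $\|f(x)-f(y)\|_p\le\lambda\|x-y\|_p$ for all $x,y\in[0,1]^d$. A point $x\in[0,1]^d$ is an $\epsilon$-approximate fixpoint if $\|f(x)-x\|_p\le\epsilon$. A query consists of choosing a point $x\in[0,1]^d$ and receiving $f(x)$.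
   Formalization: In the query bound, log(1/ε) is replaced by max(1, log₂(1/ε)), since for ε near or above 1 the literal bound can be zero or negative and fails (e.g. p=1, d=4, ε=1, λ=0); for ε ≤ 1/2 the bound is unchanged. *)

theory Defs
  imports "HOL-Analysis.Analysis"
begin

text \<open>
  The dimension \<open>d\<close> is an input of the algorithm, so points of \<open>\<real>\<^sup>d\<close> are functions on the index
  set \<open>{..<d}\<close>. Points of the cube are extensional, so that they are determined by their
  \<open>d\<close> coordinates.
\<close>

definition cube :: "nat \<Rightarrow> (nat \<Rightarrow> real) set" where
  "cube d = {..<d} \<rightarrow>\<^sub>E {0..1}"

text \<open>
  Inserting \<open>0\<close> does not change the maximum for \<open>d > 0\<close>; it gives the zero norm for \<open>d = 0\<close>.
\<close>

definition lp_norm :: "ereal \<Rightarrow> nat \<Rightarrow> (nat \<Rightarrow> real) \<Rightarrow> real" where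
  "lp_norm p d x =
     (if p = \<infinity> then Max (insert 0 ((\<lambda>i. \<bar>x i\<bar>) ` {..<d}))
      else (\<Sum>i<d. \<bar>x i\<bar> powr real_of_ereal p) powr (1 / real_of_ereal p))"

definition contracting :: "ereal \<Rightarrow> nat \<Rightarrow> real \<Rightarrow> ((nat \<Rightarrow> real) \<Rightarrow> (nat \<Rightarrow> real)) \<Rightarrow> bool" where
  "contracting p d lam f \<longleftrightarrow>
     (\<forall>x\<in>cube d. \<forall>y\<in>cube d.
        lp_norm p d (\<lambda>i. f x i - f y i) \<le> lam * lp_norm p d (\<lambda>i. x i - y i))"

definition approx_fixpoint ::
    "ereal \<Rightarrow> nat \<Rightarrow> real \<Rightarrow> ((nat \<Rightarrow> real) \<Rightarrow> (nat \<Rightarrow> real)) \<Rightarrow> (nat \<Rightarrow> real) \<Rightarrow> bool" where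
  "approx_fixpoint p d eps f x \<longleftrightarrow> x \<in> cube d \<and> lp_norm p d (\<lambda>i. f x i - x i) \<le> eps"

text \<open>
  Deterministic adaptive query algorithms as decision trees: the algorithm either stops with
  an output, or queries a point and continues depending on the answer.
  The map \<open>f\<close> is accessed only through the answers to the queries.
\<close>

datatype 'a query_alg = Return 'a | Query 'a "'a \<Rightarrow> 'a query_alg"

primrec result :: "('a \<Rightarrow> 'a) \<Rightarrow> 'a query_alg \<Rightarrow> 'a" where
  "result f (Return x) = x"
| "result f (Query x k) = result f (k (f x))"

primrec queries :: "('a \<Rightarrow> 'a) \<Rightarrow> 'a query_alg \<Rightarrow> 'a list" where
  "queries f (Return x) = []"
| "queries f (Query x k) = x # queries f (k (f x))"

end

theory Submission
  imports Defs
begin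

text \<open>
  Fix \<open>1 < q < \<infinity>\<close>, and let \<open>\<phi> t = sgn t * \<bar>t\<bar> powr (q - 1)\<close>, so that \<open>(\<phi> (x i - z i))\<^sub>i\<close> is the gradient of
  \<open>\<parallel>x - z\<parallel>\<^sup>q / q\<close> with respect to \<open>x\<close>. By convexity a candidate \<open>z\<close> for the fixpoint is refuted by the
  answer \<open>f x\<close> if this gradient has nonnegative inner product with \<open>v = f x - x\<close>. Every finite set
  \<open>Z\<close> of candidates has a centerpoint: a point \<open>x\<close> for which at least \<open>card Z / (d + 1)\<close> candidates are
  refuted whatever \<open>v\<close> is. Otherwise each \<open>x\<close> has a bad direction, which remains bad nearby; gluing these
  directions gives a continuous vector field, and at a solution of the variational inequality of this field
  (Brouwer, here through Kuhn's lemma) Caratheodory's theorem provides a candidate that is not refuted by the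
  at most \<open>d + 1\<close> bad directions involved, which contradicts the signs at the boundary of the cube.

  The candidates are the points of a grid of mesh about \<open>(1 - \<lambda>) \<epsilon> / d\<close>: the one next to the
  fixpoint is never refuted before an approximate fixpoint is found. This takes
  \<open>O(d\<^sup>2 (log (1/\<epsilon>) + log (1/(1 - \<lambda>)) + log d))\<close> queries. The term \<open>log d\<close> is absorbed if
  \<open>d \<le> 1/(1 - \<lambda>)\<close>, and otherwise Banach iteration is fast enough. Finally \<open>p = 1\<close> and \<open>p = \<infinity>\<close> reduce
  to some \<open>q\<close> so close to \<open>p\<close> that \<open>f\<close> still contracts with factor \<open>(1 + \<lambda>)/2\<close>.
\<close>

subsection \<open>Variational inequalities on the cube\<close>

lemma cube_memI: "\<lbrakk>\<And>i. i < d \<Longrightarrow> 0 \<le> x i \<and> x i \<le> 1; \<And>i. \<not> i < d \<Longrightarrow> x i = undefined\<rbrakk> \<Longrightarrow> x \<in> cube d"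
  by (auto simp: cube_def PiE_iff extensional_def)

lemma cube_memD: "x \<in> cube d \<Longrightarrow> i < d \<Longrightarrow> 0 \<le> x i" "x \<in> cube d \<Longrightarrow> i < d \<Longrightarrow> x i \<le> 1"
  "x \<in> cube d \<Longrightarrow> \<not> i < d \<Longrightarrow> x i = undefined"
  by (auto simp: cube_def PiE_iff extensional_def)

text \<open>Tychonoff's theorem: extensionality makes the cube a product over all indices, with the
  one-point factor \<open>{undefined}\<close> at indices outside \<open>{..<d}\<close>.\<close>

lemma compact_cube: "compact (cube d)"
proof -
  define S :: "nat \<Rightarrow> real set" where "S i = (if i < d then {0..1} else {undefined})" for i
  have "x \<in> cube d \<longleftrightarrow> (\<forall>i. x i \<in> S i)" for x
  proof
    assume x: "x \<in> cube d"
    show "\<forall>i. x i \<in> S i"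
    proof
      fix i show "x i \<in> S i"
        using cube_memD[OF x, of i] cube_memD(3)[OF x, of i] by (cases "i < d") (simp_all add: S_def)
    qed
  next
    assume x: "\<forall>i. x i \<in> S i"
    show "x \<in> cube d"
    proof (rule cube_memI)
      fix i
      show "0 \<le> x i \<and> x i \<le> 1" if "i < d"
        using x[rule_format, of i] that by (simp add: S_def)
      show "x i = undefined" if "\<not> i < d"
        using x[rule_format, of i] that by (simp add: S_def)
    qed
  qed
  then have eq: "cube d = PiE UNIV S"
    by (intro set_eqI) (simp only: PiE_UNIV_domain Pi_iff UNIV_I simp_thms ball_UNIV)
  have "compactin (product_topology (\<lambda>i. euclidean) UNIV) (cube d)"
    unfolding eq compactin_PiE by (simp add: S_def)
  then show ?thesis
    by (simp only: euclidean_product_topology compactin_euclidean_iff)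
qed

lemma tendsto_fun_coordinatewise:
  fixes X :: "nat \<Rightarrow> 'a \<Rightarrow> 'b::topological_space"
  assumes "\<And>i. (\<lambda>n. X n i) \<longlonglongrightarrow> x i"
  shows "X \<longlonglongrightarrow> x"
proof -
  have "limitin (product_topology (\<lambda>i. euclidean) UNIV) X x sequentially"
    using assms by (simp add: limitin_componentwise)
  then show ?thesis
    by (simp only: euclidean_product_topology limitin_canonical_iff)
qed

text \<open>The conclusion is the coordinatewise form of <w(x), y - x> \<le> 0 for all y in the
  cube. Kuhn's lemma, applied to the signs of \<open>w\<close> on the grid of mesh
  \<open>1 / Suc m\<close>, gives approximate solutions, and compactness gives a limit of
  them.\<close>

lemma cube_variational_inequality:
  fixes w :: "(nat \<Rightarrow> real) \<Rightarrow> nat \<Rightarrow> real"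
  assumes cont: "\<And>i. i < d \<Longrightarrow> continuous_on (cube d) (\<lambda>x. w x i)"
  obtains x where "x \<in> cube d"
    and "\<forall>i<d. x i = 0 \<or> 0 \<le> w x i"
    and "\<forall>i<d. x i = 1 \<or> w x i \<le> 0"
proof -
  define sc :: "nat \<Rightarrow> (nat \<Rightarrow> nat) \<Rightarrow> nat \<Rightarrow> real"
    where "sc m q = (\<lambda>j. if j < d then real (q j) / real (Suc m) else undefined)" for m q
  have sc_cube: "sc m q \<in> cube d" if "\<And>j. j < d \<Longrightarrow> q j \<le> Suc m" for m q
  proof (rule cube_memI)
    fix i assume "i < d"
    moreover from this have "real (q i) \<le> real (Suc m)"
      using that by (intro of_nat_mono)
    ultimately show "0 \<le> sc m q i \<and> sc m q i \<le> 1"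
      by (simp add: sc_def)
  qed (simp add: sc_def)
  define near :: "(nat \<Rightarrow> nat) \<Rightarrow> (nat \<Rightarrow> nat) \<Rightarrow> bool"
    where "near q r \<longleftrightarrow> (\<forall>j<d. q j \<le> r j \<and> r j \<le> q j + 1)" for q r
  \<comment> \<open>The discrete form of the conclusion in coordinate \<open>i\<close>: its two
    halves are witnessed by vertices \<open>r\<close> and \<open>s\<close> of one grid cell with
    lowest corner \<open>q\<close>.\<close>
  define opp where "opp m q i r s \<longleftrightarrow> near q r \<and> near q s \<and>
      (r i = 0 \<or> 0 \<le> w (sc m r) i) \<and> (s i = Suc m \<or> w (sc m s) i \<le> 0)" for m q i r s
  have "\<exists>q. (\<forall>i<d. q i < Suc m) \<and> (\<forall>i<d. \<exists>r s. opp m q i r s)" for m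
  proof -
    \<comment> \<open>Kuhn's lemma prescribes label 0 on the face \<open>x i = 0\<close> and label 1
      on the opposite face; in between the label records the sign of \<open>w\<close>.\<close>
    define lab :: "(nat \<Rightarrow> nat) \<Rightarrow> nat \<Rightarrow> nat"
      where "lab x i = (if x i = 0 \<or> x i \<noteq> Suc m \<and> 0 \<le> w (sc m x) i then 0 else 1)" for x i
    have lab: "\<forall>x. (\<forall>i<d. x i \<le> Suc m) \<longrightarrow> (\<forall>i<d. lab x i = 0 \<or> lab x i = 1)"
      "\<forall>x. (\<forall>i<d. x i \<le> Suc m) \<longrightarrow> (\<forall>i<d. x i = 0 \<longrightarrow> lab x i = 0)"
      "\<forall>x. (\<forall>i<d. x i \<le> Suc m) \<longrightarrow> (\<forall>i<d. x i = Suc m \<longrightarrow> lab x i = 1)"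
      by (simp_all add: lab_def)
    obtain q where q: "\<forall>i<d. q i < Suc m"
      and rs: "\<forall>i<d. \<exists>r s. (\<forall>j<d. q j \<le> r j \<and> r j \<le> q j + 1) \<and>
        (\<forall>j<d. q j \<le> s j \<and> s j \<le> q j + 1) \<and> lab r i \<noteq> lab s i"
      by (rule kuhn_lemma[OF zero_less_Suc lab])
    have "\<exists>r s. opp m q i r s" if i: "i < d" for i
    proof -
      obtain r s where 1: "near q r" "near q s" and "lab r i \<noteq> lab s i"
        using rs[folded near_def] i by auto
      then consider "lab r i = 0" "lab s i = 1" | "lab s i = 0" "lab r i = 1"
        by (auto simp: lab_def split: if_splits)
      moreover have "x i = 0 \<or> 0 \<le> w (sc m x) i" if "lab x i = 0" for x
        using that by (auto simp: lab_def split: if_splits)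
      moreover have "x i = Suc m \<or> w (sc m x) i \<le> 0" if "lab x i = 1" for x
        using that by (auto simp: lab_def split: if_splits)
      ultimately show ?thesis
        using 1 unfolding opp_def by cases metis+
    qed
    with q show ?thesis by blast
  qed
  then have "\<exists>q. \<forall>m. (\<forall>i<d. q m i < Suc m) \<and> (\<forall>i<d. \<exists>r s. opp m (q m) i r s)"
    by (rule choice[OF allI])
  then obtain q where q: "\<And>m i. i < d \<Longrightarrow> q m i < Suc m"
    and q': "\<And>m i. i < d \<Longrightarrow> \<exists>r s. opp m (q m) i r s"
    by blast
  define r where "r m i = (SOME r. \<exists>s. opp m (q m) i r s)" for m i
  define s where "s m i = (SOME s. opp m (q m) i (r m i) s)" for m i
  have rs: "opp m (q m) i (r m i) (s m i)" if "i < d" for m i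
    unfolding s_def using someI_ex[OF q'[OF that, of m]] unfolding r_def[symmetric] by (rule someI_ex)
  have nr: "near (q m) (r m i)" and ns: "near (q m) (s m i)"
    and r: "r m i i = 0 \<or> 0 \<le> w (sc m (r m i)) i"
    and s: "s m i i = Suc m \<or> w (sc m (s m i)) i \<le> 0" if "i < d" for m i
    using rs[OF that, of m] by (simp_all add: opp_def)
  have near_cube: "sc m r' \<in> cube d" if "near (q m) r'" for m r'
  proof (rule sc_cube)
    fix j assume "j < d"
    then have "q m j < Suc m" "r' j \<le> q m j + 1"
      using q that by (simp_all add: near_def)
    then show "r' j \<le> Suc m" by simp
  qed
  have "sc m (q m) \<in> cube d" for m
    using q[of _ m] by (intro sc_cube) (simp add: less_imp_le)
  then obtain x \<sigma> where x: "x \<in> cube d" and \<sigma>: "strict_mono \<sigma>"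
    and lim: "((\<lambda>m. sc m (q m)) \<circ> \<sigma>) \<longlonglongrightarrow> x"
    using seq_compactE[OF compact_cube[of d, unfolded compact_eq_seq_compact_metric], of "\<lambda>m. sc m (q m)"]
    by blast
  \<comment> \<open>The cells shrink to a point, so every choice of vertices has the same limit as
    the lowest corners.\<close>
  have near_lim: "(\<lambda>m. sc (\<sigma> m) (t (\<sigma> m))) \<longlonglongrightarrow> x" if t: "\<And>m. near (q m) (t m)" for t
  proof (rule tendsto_fun_coordinatewise)
    fix j
    show "(\<lambda>m. sc (\<sigma> m) (t (\<sigma> m)) j) \<longlonglongrightarrow> x j"
    proof (cases "j < d")
      case False
      then show ?thesis
        using x by (auto simp: sc_def cube_def PiE_iff extensional_def)
    next
      case True
      have lj: "(\<lambda>m. sc (\<sigma> m) (q (\<sigma> m)) j) \<longlonglongrightarrow> x j"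
        using continuous_on_tendsto_compose[OF continuous_on_product_coordinates[of j] lim]
        by simp
      have "(\<lambda>m. sc (\<sigma> m) (q (\<sigma> m)) j + 1 / real (Suc (\<sigma> m))) \<longlonglongrightarrow> x j + 0"
        using LIMSEQ_subseq_LIMSEQ[OF LIMSEQ_inverse_real_of_nat \<sigma>]
        by (intro tendsto_add lj) (simp add: o_def inverse_eq_divide)
      then have up: "(\<lambda>m. sc (\<sigma> m) (q (\<sigma> m)) j + 1 / real (Suc (\<sigma> m))) \<longlonglongrightarrow> x j"
        by simp
      show ?thesis
      proof (rule tendsto_sandwich[OF _ _ lj up])
        show "\<forall>\<^sub>F m in sequentially. sc (\<sigma> m) (q (\<sigma> m)) j \<le> sc (\<sigma> m) (t (\<sigma> m)) j"
          using t True by (intro always_eventually allI) (simp add: sc_def near_def divide_right_mono)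
        show "\<forall>\<^sub>F m in sequentially. sc (\<sigma> m) (t (\<sigma> m)) j
            \<le> sc (\<sigma> m) (q (\<sigma> m)) j + 1 / real (Suc (\<sigma> m))"
        proof (intro always_eventually allI)
          fix m
          have "t (\<sigma> m) j \<le> q (\<sigma> m) j + 1"
            using t[of "\<sigma> m"] True by (simp add: near_def)
          then have "real (t (\<sigma> m) j) \<le> real (q (\<sigma> m) j) + 1"
            by linarith
          then have "real (t (\<sigma> m) j) / real (Suc (\<sigma> m)) \<le> (real (q (\<sigma> m) j) + 1) / real (Suc (\<sigma> m))"
            by (rule divide_right_mono) simp
          then show "sc (\<sigma> m) (t (\<sigma> m)) j \<le> sc (\<sigma> m) (q (\<sigma> m)) j + 1 / real (Suc (\<sigma> m))"
            using True by (simp add: sc_def add_divide_distrib)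
        qed
      qed
    qed
  qed
  have coord_lim: "(\<lambda>m. sc (\<sigma> m) (t (\<sigma> m)) i) \<longlonglongrightarrow> x i"
    and w_lim: "(\<lambda>m. w (sc (\<sigma> m) (t (\<sigma> m))) i) \<longlonglongrightarrow> w x i"
    if "i < d" "\<And>m. near (q m) (t m)" for i t
  proof -
    show "(\<lambda>m. sc (\<sigma> m) (t (\<sigma> m)) i) \<longlonglongrightarrow> x i"
      using continuous_on_tendsto_compose[OF continuous_on_product_coordinates[of i] near_lim[of t]] that
      by simp
    show "(\<lambda>m. w (sc (\<sigma> m) (t (\<sigma> m))) i) \<longlonglongrightarrow> w x i"
      using that x near_cube by (intro continuous_on_tendsto_compose[OF cont near_lim]) auto
  qed
  show thesis
  proof (rule that[OF x]; intro allI impI)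
    fix i assume i: "i < d"
    show "x i = 0 \<or> 0 \<le> w x i"
    proof (rule ccontr)
      assume "\<not> ?thesis"
      then have "0 < x i" "w x i < 0"
        using cube_memD(1)[OF x i] by auto
      \<comment> \<open>Strict inequalities at the limit persist at the vertices of all late cells,
        where they contradict the choice of \<open>r\<close>.\<close>
      then have "\<forall>\<^sub>F m in sequentially. 0 < sc (\<sigma> m) (r (\<sigma> m) i) i \<and> w (sc (\<sigma> m) (r (\<sigma> m) i)) i < 0"
        by (intro eventually_conj order_tendstoD(1)[OF coord_lim[of i "\<lambda>m. r m i"]]
          order_tendstoD(2)[OF w_lim[of i "\<lambda>m. r m i"]] i nr[OF i])
      then obtain m where "0 < sc (\<sigma> m) (r (\<sigma> m) i) i" "w (sc (\<sigma> m) (r (\<sigma> m) i)) i < 0"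
        using eventually_happens'[OF sequentially_bot] by (metis (no_types, lifting))
      then show False
        using r[OF i, of "\<sigma> m"] i by (auto simp: sc_def)
    qed
    show "x i = 1 \<or> w x i \<le> 0"
    proof (rule ccontr)
      assume "\<not> ?thesis"
      then have "x i < 1" "0 < w x i"
        using cube_memD(2)[OF x i] by auto
      then have "\<forall>\<^sub>F m in sequentially. sc (\<sigma> m) (s (\<sigma> m) i) i < 1 \<and> 0 < w (sc (\<sigma> m) (s (\<sigma> m) i)) i"
        by (intro eventually_conj order_tendstoD(2)[OF coord_lim[of i "\<lambda>m. s m i"]]
          order_tendstoD(1)[OF w_lim[of i "\<lambda>m. s m i"]] i ns[OF i])
      then obtain m where "sc (\<sigma> m) (s (\<sigma> m) i) i < 1" "0 < w (sc (\<sigma> m) (s (\<sigma> m) i)) i"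
        using eventually_happens'[OF sequentially_bot] by (metis (no_types, lifting))
      then show False
        using s[OF i, of "\<sigma> m"] i by (auto simp: sc_def)
    qed
  qed
qed

subsection \<open>Caratheodory's theorem for cones\<close>

text \<open>Gaussian elimination: an unknown with nonzero coefficient in the last equation is
  eliminated, which leaves one equation and one unknown fewer.\<close>

lemma homogeneous_system_nontrivial_solution:
  fixes u :: "nat \<Rightarrow> 'a \<Rightarrow> real"
  assumes "finite J" "m < card J"
  shows "\<exists>c. (\<exists>j\<in>J. c j \<noteq> 0) \<and> (\<forall>i<m. (\<Sum>j\<in>J. c j * u i j) = 0)"
  using assms
proof (induction m arbitrary: J u)
  case 0
  then obtain j where "j \<in> J" by fastforce
  then show ?case by (intro exI[of _ "\<lambda>_. 1"]) auto
next
  case (Suc m)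
  show ?case
  proof (cases "\<forall>j\<in>J. u m j = 0")
    case True
    obtain c where c: "\<exists>j\<in>J. c j \<noteq> 0" "\<forall>i<m. (\<Sum>j\<in>J. c j * u i j) = 0"
      using Suc.IH[of J u] Suc.prems by auto
    moreover have "(\<Sum>j\<in>J. c j * u m j) = 0"
      using True by simp
    ultimately show ?thesis
      by (metis less_Suc_eq)
  next
    case False
    then obtain k where k: "k \<in> J" "u m k \<noteq> 0" by blast
    define u' where "u' i j = u i j - u i k * u m j / u m k" for i j
    have "m < card (J - {k})"
      using Suc.prems k by simp
    then obtain c where c: "\<exists>j\<in>J-{k}. c j \<noteq> 0" "\<And>i. i < m \<Longrightarrow> (\<Sum>j\<in>J-{k}. c j * u' i j) = 0"
      using Suc.IH[of "J - {k}" u'] Suc.prems by auto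
    \<comment> \<open>The value at \<open>k\<close> is chosen so as to solve equation
      \<open>m\<close>; the other equations then become those of the reduced system
      \<open>u'\<close>.\<close>
    define c' where "c' = c(k := - (\<Sum>j\<in>J-{k}. c j * u m j) / u m k)"
    have split: "(\<Sum>j\<in>J. c' j * u i j)
        = (\<Sum>j\<in>J-{k}. c j * u i j) - u i k * (\<Sum>j\<in>J-{k}. c j * u m j) / u m k" for i
    proof -
      have "(\<Sum>j\<in>J. c' j * u i j) = c' k * u i k + (\<Sum>j\<in>J-{k}. c' j * u i j)"
        using k Suc.prems(1) by (simp add: sum.remove)
      also have "(\<Sum>j\<in>J-{k}. c' j * u i j) = (\<Sum>j\<in>J-{k}. c j * u i j)"
        by (rule sum.cong) (auto simp: c'_def)
      finally show ?thesis
        by (simp add: c'_def)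
    qed
    have "(\<Sum>j\<in>J. c' j * u i j) = 0" if "i < Suc m" for i
    proof (cases "i = m")
      case True
      then show ?thesis
        using k by (simp add: split)
    next
      case False
      have "(\<Sum>j\<in>J. c' j * u i j) = (\<Sum>j\<in>J-{k}. c j * u' i j)"
        unfolding split u'_def
        by (simp add: right_diff_distrib sum_subtractf sum_distrib_left sum_divide_distrib mult_ac)
      then show ?thesis
        using c(2)[of i] that False by simp
    qed
    moreover have "\<exists>j\<in>J. c' j \<noteq> 0"
      using c(1) by (auto simp: c'_def)
    ultimately show ?thesis by blast
  qed
qed

text \<open>As long as there are more than \<open>d + 1\<close> vectors, a multiple of a linear
  dependency is subtracted until a coefficient vanishes. The bound is \<open>d + 1\<close> and not
  \<open>d\<close> because the dependency must also sum to 0: this preserves the total weight and so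
  keeps \<open>K\<close> nonempty.\<close>

lemma conic_caratheodory:
  fixes v :: "'a \<Rightarrow> nat \<Rightarrow> real"
  assumes "finite J" "J \<noteq> {}" "\<And>j. j \<in> J \<Longrightarrow> 0 < a j"
  shows "\<exists>K b. K \<subseteq> J \<and> K \<noteq> {} \<and> card K \<le> d + 1 \<and> (\<forall>j\<in>K. 0 < b j) \<and>
    (\<forall>i<d. (\<Sum>j\<in>K. b j * v j i) = (\<Sum>j\<in>J. a j * v j i))"
  using assms
proof (induction "card J" arbitrary: J a rule: less_induct)
  case less
  show ?case
  proof (cases "card J \<le> d + 1")
    case True
    then show ?thesis using less.prems by blast
  next
    case False
    \<comment> \<open>Row \<open>d\<close> consists of ones and forces the coefficients
      \<open>c\<close> to sum to 0; being nontrivial, they then include a positive one.\<close>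
    define u where "u i j = (if i < d then v j i else 1)" for i j
    obtain c where c: "\<exists>j\<in>J. c j \<noteq> 0" "\<And>i. i < d + 1 \<Longrightarrow> (\<Sum>j\<in>J. c j * u i j) = 0"
      using homogeneous_system_nontrivial_solution[of J "d + 1" u] less.prems(1) False by auto
    have csum: "(\<Sum>j\<in>J. c j) = 0"
      using c(2)[of d] by (simp add: u_def)
    have cv: "(\<Sum>j\<in>J. c j * v j i) = 0" if "i < d" for i
      using c(2)[of i] that by (simp add: u_def)
    define P where "P = {j\<in>J. 0 < c j}"
    have "P \<noteq> {}"
    proof
      assume "P = {}"
      then have "\<And>j. j \<in> J \<Longrightarrow> 0 \<le> - c j" by (force simp: P_def)
      then have "\<forall>j\<in>J. - c j = 0"
        using sum_nonneg_eq_0_iff[of J "\<lambda>j. - c j"] csum less.prems(1) by (simp add: sum_negf)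
      with c(1) show False by simp
    qed
    have finP: "finite P" using less.prems(1) by (simp add: P_def)
    \<comment> \<open>The largest \<open>t\<close> for which \<open>a j - t * c j\<close> stays
      nonnegative for all \<open>j\<close>; an index \<open>k\<close> attaining the minimum drops
      out.\<close>
    define t where "t = Min ((\<lambda>j. a j / c j) ` P)"
    obtain k where k: "k \<in> P" "t = a k / c k"
      using Min_in[of "(\<lambda>j. a j / c j) ` P"] finP \<open>P \<noteq> {}\<close> unfolding t_def by blast
    have t_le: "t \<le> a j / c j" if "j \<in> P" for j
      using finP that by (simp add: t_def)
    have "0 < t"
      using k less.prems(3)[of k] by (simp add: P_def)
    define b where "b j = a j - t * c j" for j
    have b_nonneg: "0 \<le> b j" if "j \<in> J" for j
    proof (cases "j \<in> P")
      case True
      then show ?thesis using t_le[of j] by (simp add: b_def P_def pos_le_divide_eq)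
    next
      case False
      then have "t * c j \<le> 0"
        using that \<open>0 < t\<close> by (simp add: P_def mult_le_0_iff)
      then show ?thesis using less.prems(3)[OF that] by (simp add: b_def)
    qed
    define K where "K = {j\<in>J. 0 < b j}"
    have sumK: "(\<Sum>j\<in>K. b j * g j) = (\<Sum>j\<in>J. b j * g j)" for g :: "'a \<Rightarrow> real"
      using less.prems(1) b_nonneg by (intro sum.mono_neutral_left) (force simp: K_def)+
    have "b k = 0" using k by (simp add: b_def P_def)
    then have "k \<in> J" "k \<notin> K" using k by (auto simp: K_def P_def)
    then have "K \<subset> J" by (auto simp: K_def)
    moreover have "K \<noteq> {}"
    proof
      assume "K = {}"
      then have "(\<Sum>j\<in>J. b j) = 0" using sumK[of "\<lambda>_. 1"] by simp
      moreover have "(\<Sum>j\<in>J. b j) = (\<Sum>j\<in>J. a j)"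
        using csum by (simp add: b_def sum_subtractf flip: sum_distrib_left)
      moreover have "0 < (\<Sum>j\<in>J. a j)"
        using less.prems by (intro sum_pos) auto
      ultimately show False by simp
    qed
    moreover have "(\<Sum>j\<in>K. b j * v j i) = (\<Sum>j\<in>J. a j * v j i)" if "i < d" for i
    proof -
      have "(\<Sum>j\<in>J. b j * v j i) = (\<Sum>j\<in>J. a j * v j i) - t * (\<Sum>j\<in>J. c j * v j i)"
        by (simp add: b_def left_diff_distrib sum_subtractf sum_distrib_left mult.assoc)
      then show ?thesis using cv[OF that] sumK by simp
    qed
    moreover have "\<exists>L e. L \<subseteq> K \<and> L \<noteq> {} \<and> card L \<le> d + 1 \<and> (\<forall>j\<in>L. 0 < e j) \<and>
        (\<forall>i<d. (\<Sum>j\<in>L. e j * v j i) = (\<Sum>j\<in>K. b j * v j i))"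
      using \<open>K \<subset> J\<close> \<open>K \<noteq> {}\<close> less.prems(1)
      by (intro less.hyps) (auto simp: K_def intro: psubset_card_mono finite_subset)
    ultimately show ?thesis
      by (smt (verit) psubset_imp_subset subset_trans)
  qed
qed

subsection \<open>Nonlinear centerpoints\<close>

text \<open>For \<phi> the identity this is the classical centerpoint theorem for halfspaces. For
  other \<phi> the sets of candidates need not be halfspaces, so the argument is topological; the
  signs of \<phi> matter only on the boundary of the cube.\<close>

theorem nonlinear_centerpoint:
  fixes \<phi> :: "real \<Rightarrow> real"
  assumes cont: "continuous_on UNIV \<phi>"
    and pos: "\<And>t. 0 \<le> t \<Longrightarrow> 0 \<le> \<phi> t" and neg: "\<And>t. t \<le> 0 \<Longrightarrow> \<phi> t \<le> 0"
    and Z: "finite Z" "Z \<subseteq> cube d"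
  obtains c where "c \<in> cube d"
    and "\<forall>v. card Z \<le> (d + 1) * card {z \<in> Z. 0 \<le> (\<Sum>i<d. \<phi> (c i - z i) * v i)}"
proof (rule ccontr)
  define G where "G x z v = (\<Sum>i<d. \<phi> (x i - z i) * v i)" for x z v :: "nat \<Rightarrow> real"
  have contG: "continuous_on UNIV (\<lambda>x. G x z v)" for z v
  proof -
    have "continuous_on UNIV (\<lambda>x::nat \<Rightarrow> real. \<phi> (x i - z i))" for i
      by (rule continuous_on_compose2[OF cont])
        (simp_all add: continuous_on_diff)
    then show ?thesis
      unfolding G_def by (intro continuous_on_sum continuous_on_mult continuous_on_const)
  qed
  note center = that
  assume contra: "\<not> thesis"
  have "\<exists>v. (d + 1) * card {z \<in> Z. 0 \<le> G x z v} < card Z" if x: "x \<in> cube d" for x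
  proof (rule ccontr)
    assume none: "\<not> ?thesis"
    have "thesis"
    proof (rule center[OF x], rule allI)
      fix v
      show "card Z \<le> (d + 1) * card {z \<in> Z. 0 \<le> (\<Sum>i<d. \<phi> (x i - z i) * v i)}"
        using none unfolding G_def not_ex not_less by (rule spec)
    qed
    with contra show False by contradiction
  qed
  then obtain v where v: "\<And>x. x \<in> cube d \<Longrightarrow> (d + 1) * card {z \<in> Z. 0 \<le> G x z (v x)} < card Z"
    by metis
  \<comment> \<open>The candidates that the bad direction \<open>v x\<close> leaves unrefuted at
    \<open>x\<close>: more than \<open>d / (d + 1)\<close> of all.\<close>
  define S where "S x = {z \<in> Z. G x z (v x) < 0}" for x
  have finS: "finite (S x)" for x
    using Z by (simp add: S_def)
  \<comment> \<open>The finitely many strict inequalities that define \<open>S x\<close> remain true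
    near \<open>x\<close>, so compactness reduces the bad directions to a finite set
    \<open>D\<close>.\<close>
  have "open {y. \<forall>z\<in>S x. G y z (v x) < 0}" for x
  proof -
    have "{y. \<forall>z\<in>S x. G y z (v x) < 0} = (\<Inter>z\<in>S x. {y. G y z (v x) < 0})"
      by blast
    moreover have "open {y. G y z (v x) < 0}" for z
      by (intro open_Collect_less contG continuous_on_const)
    ultimately show ?thesis
      using finS by (simp add: open_INT)
  qed
  moreover have "cube d \<subseteq> (\<Union>x\<in>cube d. {y. \<forall>z\<in>S x. G y z (v x) < 0})"
    by (auto simp: S_def)
  ultimately obtain D where D: "D \<subseteq> cube d" "finite D"
    and cover: "cube d \<subseteq> (\<Union>x\<in>D. {y. \<forall>z\<in>S x. G y z (v x) < 0})"
    by (rule compactE_image[OF compact_cube])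
  \<comment> \<open>A continuous weight, positive exactly where \<open>v x\<close> still leaves all
    of \<open>S x\<close> unrefuted. It plays the part of a partition of unity; no normalization is
    made, as only the signs of \<open>w\<close> are used.\<close>
  define a where "a x y = (\<Prod>z\<in>S x. max 0 (- G y z (v x)))" for x y
  have a_nonneg: "0 \<le> a x y" for x y
    by (simp add: a_def prod_nonneg)
  have a_pos: "0 < a x y \<longleftrightarrow> (\<forall>z\<in>S x. G y z (v x) < 0)" for x y
  proof -
    have "a x y \<noteq> 0 \<longleftrightarrow> (\<forall>z\<in>S x. G y z (v x) < 0)"
      unfolding a_def using finS by (auto simp: max_def)
    then show ?thesis
      using a_nonneg[of x y] by (simp add: less_le)
  qed
  have cont_a: "continuous_on T (a x)" for T x
    unfolding a_def
    by (intro continuous_on_prod continuous_on_max continuous_on_const continuous_on_minus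
        continuous_on_subset[OF contG] subset_UNIV)
  define w where "w y i = (\<Sum>x\<in>D. a x y * v x i)" for y i
  have cont_w: "continuous_on (cube d) (\<lambda>y. w y i)" for i
    unfolding w_def by (intro continuous_on_sum continuous_on_mult continuous_on_const cont_a)
  obtain y where y: "y \<in> cube d"
    and y0: "\<forall>i<d. y i = 0 \<or> 0 \<le> w y i" and y1: "\<forall>i<d. y i = 1 \<or> w y i \<le> 0"
    by (rule cube_variational_inequality[of d w, OF cont_w])
  define J where "J = {x \<in> D. 0 < a x y}"
  have "J \<noteq> {}"
    using cover y by (auto simp: J_def a_pos)
  moreover have "finite J"
    using D by (simp add: J_def)
  ultimately have "\<exists>K b. K \<subseteq> J \<and> K \<noteq> {} \<and> card K \<le> d + 1 \<and> (\<forall>j\<in>K. 0 < b j) \<and>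
      (\<forall>i<d. (\<Sum>j\<in>K. b j * v j i) = (\<Sum>j\<in>J. a j y * v j i))"
    by (intro conic_caratheodory) (simp_all add: J_def)
  then obtain K b where K: "K \<subseteq> J" "K \<noteq> {}" "card K \<le> d + 1"
    and b: "\<forall>j\<in>K. 0 < b j" and Kw: "\<forall>i<d. (\<Sum>j\<in>K. b j * v j i) = (\<Sum>j\<in>J. a j y * v j i)"
    by (elim exE conjE) (rule that)
  have finK: "finite K"
    using K \<open>finite J\<close> by (auto intro: finite_subset)
  have w_eq: "w y i = (\<Sum>j\<in>K. b j * v j i)" if "i < d" for i
  proof -
    have "w y i = (\<Sum>j\<in>J. a j y * v j i)"
      unfolding w_def J_def using D a_nonneg by (intro sum.mono_neutral_right) (auto simp: less_le)
    then show ?thesis using Kw that by simp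
  qed
  \<comment> \<open>The complement of each \<open>S x\<close> has fewer than
    \<open>card Z / (d + 1)\<close> elements, and at most \<open>d + 1\<close> such complements
    cannot cover \<open>Z\<close>.\<close>
  have "\<exists>z\<in>Z. \<forall>x\<in>K. z \<in> S x"
  proof (rule ccontr)
    assume "\<not> ?thesis"
    then have "Z \<subseteq> (\<Union>x\<in>K. {z \<in> Z. 0 \<le> G x z (v x)})"
      by (fastforce simp: S_def not_less)
    then have "card Z \<le> card (\<Union>x\<in>K. {z \<in> Z. 0 \<le> G x z (v x)})"
      using Z finK by (intro card_mono) auto
    also have "\<dots> \<le> (\<Sum>x\<in>K. card {z \<in> Z. 0 \<le> G x z (v x)})"
      by (rule card_UN_le[OF finK])
    finally have "(d + 1) * card Z \<le> (\<Sum>x\<in>K. (d + 1) * card {z \<in> Z. 0 \<le> G x z (v x)})"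
      by (simp only: sum_distrib_left[symmetric] mult_le_mono2)
    also have "\<dots> < (\<Sum>x\<in>K. card Z)"
      using K D by (intro sum_strict_mono finK v) (auto simp: J_def)
    also have "\<dots> \<le> (d + 1) * card Z"
      using K(3) by (simp only: sum_constant of_nat_id mult_le_mono1)
    finally show False by simp
  qed
  then obtain z where z: "z \<in> Z" "\<And>x. x \<in> K \<Longrightarrow> z \<in> S x" by blast
  \<comment> \<open>At \<open>y\<close> the field is a positive combination of directions
    \<open>v j\<close>, \<open>j \<in> K\<close>, each of which has negative product with the
    gradient belonging to \<open>z\<close>.\<close>
  have "(\<Sum>i<d. \<phi> (y i - z i) * w y i) = (\<Sum>i<d. \<Sum>j\<in>K. b j * (\<phi> (y i - z i) * v j i))"
    by (simp add: w_eq sum_distrib_left mult_ac)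
  also have "\<dots> = (\<Sum>j\<in>K. b j * G y z (v j))"
    unfolding G_def sum_distrib_left by (rule sum.swap)
  also have "\<dots> < 0"
  proof -
    have "b j * G y z (v j) < 0" if "j \<in> K" for j
    proof -
      have "0 < a j y"
        using that K by (auto simp: J_def)
      then have "G y z (v j) < 0"
        using a_pos z(2)[OF that] by blast
      then show ?thesis
        using b that by (simp add: mult_pos_neg)
    qed
    then show ?thesis
      using sum_strict_mono[OF finK K(2), of "\<lambda>j. b j * G y z (v j)" "\<lambda>_. 0"] by simp
  qed
  \<comment> \<open>Where \<open>w y i\<close> is nonzero, \<open>y\<close> lies on the face towards
    which \<open>w\<close> points, so \<open>y i - z i\<close> is zero or has the same sign as
    \<open>w y i\<close>.\<close>
  moreover have "0 \<le> (\<Sum>i<d. \<phi> (y i - z i) * w y i)"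
  proof (rule sum_nonneg)
    fix i assume "i \<in> {..<d}"
    then have i: "i < d" by simp
    have zc: "0 \<le> z i" "z i \<le> 1"
      using z Z i cube_memD by blast+
    consider "w y i = 0" | "0 < w y i" "y i = 1" | "w y i < 0" "y i = 0"
      using y0[rule_format, OF i] y1[rule_format, OF i] by linarith
    then show "0 \<le> \<phi> (y i - z i) * w y i"
      by cases (use zc pos[of "1 - z i"] neg[of "- z i"] in \<open>auto simp: mult_nonpos_nonpos\<close>)
  qed
  ultimately show False by simp
qed

subsection \<open>Gradients of the norms\<close>

text \<open>For \<open>r = q - 1\<close> this is the derivative of |t|^q / q.\<close>

definition signed_powr :: "real \<Rightarrow> real \<Rightarrow> real" where
  "signed_powr r t = sgn t * \<bar>t\<bar> powr r"

lemma continuous_on_signed_powr: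
  assumes "0 < r"
  shows "continuous_on UNIV (signed_powr r)"
proof -
  \<comment> \<open>Writing the function with positive and negative parts avoids the jump of
    \<open>sgn\<close> at 0.\<close>
  have eq: "signed_powr r = (\<lambda>t. max t 0 powr r - max (- t) 0 powr r)"
    by (auto simp: signed_powr_def sgn_if max_def fun_eq_iff)
  show ?thesis
    unfolding eq by (intro continuous_intros continuous_on_powr') (use assms in auto)
qed

text \<open>A convex function lies above its tangents. After expansion this is Young's inequality
  for |b| and |a|^(q - 1) with the conjugate exponents \<open>q\<close> and
  \<open>q'\<close>.\<close>

lemma abs_powr_tangent:
  fixes a b q :: real
  assumes "1 < q"
  shows "\<bar>a\<bar> powr q + q * (signed_powr (q - 1) a * (b - a)) \<le> \<bar>b\<bar> powr q"
proof -
  define q' where "q' = q / (q - 1)"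
  have q': "1 < q'" "1 / q + 1 / q' = 1"
    using assms by (auto simp: q'_def field_simps)
  have "\<bar>b\<bar> * \<bar>a\<bar> powr (q - 1) \<le> \<bar>b\<bar> powr q / q + (\<bar>a\<bar> powr (q - 1)) powr q' / q'"
    using Youngs_inequality[of q q' "\<bar>b\<bar>" "\<bar>a\<bar> powr (q - 1)"] assms q' by simp
  also have "(\<bar>a\<bar> powr (q - 1)) powr q' = \<bar>a\<bar> powr q"
    using assms by (simp add: powr_powr q'_def)
  finally have "q * (\<bar>b\<bar> * \<bar>a\<bar> powr (q - 1)) \<le> \<bar>b\<bar> powr q + (q - 1) * \<bar>a\<bar> powr q"
    using assms by (simp add: q'_def field_simps)
  moreover have "signed_powr (q - 1) a * b \<le> \<bar>b\<bar> * \<bar>a\<bar> powr (q - 1)"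
  proof -
    have "sgn a * b \<le> \<bar>b\<bar>" by (auto simp: sgn_if)
    then have "(sgn a * b) * \<bar>a\<bar> powr (q - 1) \<le> \<bar>b\<bar> * \<bar>a\<bar> powr (q - 1)"
      by (rule mult_right_mono) simp
    then show ?thesis by (simp add: signed_powr_def mult_ac)
  qed
  moreover have "signed_powr (q - 1) a * a = \<bar>a\<bar> powr q"
  proof (cases "a = 0")
    case False
    then have "\<bar>a\<bar> powr q = \<bar>a\<bar> powr (q - 1) * \<bar>a\<bar>"
      by (simp add: powr_diff)
    then show ?thesis by (simp add: signed_powr_def sgn_if)
  qed (use assms in \<open>simp add: signed_powr_def\<close>)
  moreover have "q * (signed_powr (q - 1) a * b) \<le> q * (\<bar>b\<bar> * \<bar>a\<bar> powr (q - 1))"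
    using calculation(2) assms by simp
  ultimately show ?thesis
    by (simp add: algebra_simps)
qed

section \<open>Norms with finite exponent and Minkowski's inequality\<close>

lemma lp_norm_ereal: "lp_norm (ereal q) d x = (\<Sum>i<d. \<bar>x i\<bar> powr q) powr (1 / q)"
  by (simp add: lp_norm_def)

lemma lp_norm_nonneg [simp]: "0 \<le> lp_norm (ereal q) d x"
  by (simp add: lp_norm_ereal)

lemma lp_norm_minus_commute: "lp_norm p d (\<lambda>i. x i - y i) = lp_norm p d (\<lambda>i. y i - x i)"
  by (simp add: lp_norm_def abs_minus_commute)

lemma lp_norm_powr:
  assumes "0 < q"
  shows "lp_norm (ereal q) d x powr q = (\<Sum>i<d. \<bar>x i\<bar> powr q)"
  using assms by (simp add: lp_norm_ereal powr_powr sum_nonneg)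

lemma lp_norm_le_iff:
  assumes "0 < q" "0 \<le> c"
  shows "lp_norm (ereal q) d x \<le> c \<longleftrightarrow> (\<Sum>i<d. \<bar>x i\<bar> powr q) \<le> c powr q"
proof -
  have "lp_norm (ereal q) d x \<le> c \<longleftrightarrow> lp_norm (ereal q) d x powr q \<le> c powr q"
    using assms powr_mono2[of q "lp_norm (ereal q) d x" c] powr_less_mono2[of q c "lp_norm (ereal q) d x"]
    by (auto simp: not_le[symmetric])
  then show ?thesis using lp_norm_powr[OF assms(1)] by simp
qed

lemma convex_on_abs_powr:
  assumes "1 < q"
  shows "convex_on UNIV (\<lambda>t::real. \<bar>t\<bar> powr q)"
proof (rule convex_onI)
  fix t x y :: real
  assume t: "0 < t" "t < 1"
  define m where "m = (1 - t) * x + t * y"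
  \<comment> \<open>The linear terms of the two tangents at \<open>m\<close> cancel because
    \<open>m\<close> is the weighted mean of \<open>x\<close> and \<open>y\<close>.\<close>
  have "\<bar>m\<bar> powr q = (1 - t) * (\<bar>m\<bar> powr q + q * (signed_powr (q - 1) m * (x - m)))
      + t * (\<bar>m\<bar> powr q + q * (signed_powr (q - 1) m * (y - m)))"
    by (simp add: m_def algebra_simps)
  also have "\<dots> \<le> (1 - t) * \<bar>x\<bar> powr q + t * \<bar>y\<bar> powr q"
    using t by (intro add_mono mult_left_mono abs_powr_tangent assms) auto
  finally show "\<bar>(1 - t) *\<^sub>R x + t *\<^sub>R y\<bar> powr q \<le> (1 - t) * \<bar>x\<bar> powr q + t * \<bar>y\<bar> powr q"
    by (simp add: m_def)
qed simp

lemma lp_norm_eq_0D: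
  assumes "0 < q" "lp_norm (ereal q) d x = 0" "i < d"
  shows "x i = 0"
proof -
  have "(\<Sum>i<d. \<bar>x i\<bar> powr q) = 0"
    using lp_norm_powr[OF assms(1), of d x] assms(2) by simp
  then show ?thesis
    using assms(3) by (subst (asm) sum_nonneg_eq_0_iff) auto
qed

text \<open>For nonzero norms \<open>a\<close> and \<open>b\<close>, (x + y) / (a + b) is a convex
  combination of the unit vectors x / a and y / b, and convexity of |t|^q applies in each
  coordinate.\<close>

lemma lp_norm_triangle:
  assumes "1 < q"
  shows "lp_norm (ereal q) d (\<lambda>i. x i + y i) \<le> lp_norm (ereal q) d x + lp_norm (ereal q) d y"
proof -
  define a where "a = lp_norm (ereal q) d x"
  define b where "b = lp_norm (ereal q) d y"
  have q0: "0 < q" using assms by simp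
  have ab: "0 \<le> a" "0 \<le> b" by (simp_all add: a_def b_def)
  consider "a = 0" | "b = 0" | "0 < a" "0 < b" using ab by linarith
  then show ?thesis
  proof cases
    case 1
    then have "x i = 0" if "i < d" for i using that lp_norm_eq_0D[OF q0] by (simp add: a_def)
    then have "lp_norm (ereal q) d (\<lambda>i. x i + y i) = b" by (simp add: lp_norm_ereal b_def)
    then show ?thesis by (simp add: b_def)
  next
    case 2
    then have "y i = 0" if "i < d" for i using that lp_norm_eq_0D[OF q0] by (simp add: b_def)
    then have "lp_norm (ereal q) d (\<lambda>i. x i + y i) = a" by (simp add: lp_norm_ereal a_def)
    then show ?thesis by (simp add: a_def)
  next
    case 3
    define t where "t = b / (a + b)"
    have t: "0 \<le> t" "t \<le> 1" "1 - t = a / (a + b)"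
      using 3 by (auto simp: t_def field_simps)
    have sc: "\<bar>u / c\<bar> powr q = \<bar>u\<bar> powr q / c powr q" if "0 < c" for u c :: real
      using that by (simp add: powr_divide abs_divide)
    have "(\<Sum>i<d. \<bar>x i + y i\<bar> powr q) / (a + b) powr q = (\<Sum>i<d. \<bar>(x i + y i) / (a + b)\<bar> powr q)"
      using 3 sc[of "a + b"] by (simp add: sum_divide_distrib)
    also have "\<dots> \<le> (\<Sum>i<d. (1 - t) * \<bar>x i / a\<bar> powr q + t * \<bar>y i / b\<bar> powr q)"
    proof (rule sum_mono)
      fix i
      have "(x i + y i) / (a + b) = (1 - t) *\<^sub>R (x i / a) + t *\<^sub>R (y i / b)"
        using 3 unfolding t(3) by (simp add: t_def add_divide_distrib)
      then show "\<bar>(x i + y i) / (a + b)\<bar> powr q \<le> (1 - t) * \<bar>x i / a\<bar> powr q + t * \<bar>y i / b\<bar> powr q"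
        using convex_onD[OF convex_on_abs_powr[OF assms], of t "x i / a" "y i / b"] t by simp
    qed
    also have "\<dots> = (1 - t) * ((\<Sum>i<d. \<bar>x i\<bar> powr q) / a powr q) + t * ((\<Sum>i<d. \<bar>y i\<bar> powr q) / b powr q)"
      unfolding sc[OF 3(1)] sc[OF 3(2)] by (simp add: sum.distrib sum_distrib_left sum_divide_distrib)
    also have "\<dots> = 1"
      unfolding lp_norm_powr[OF q0, symmetric] a_def[symmetric] b_def[symmetric] using 3 by simp
    finally have "(\<Sum>i<d. \<bar>x i + y i\<bar> powr q) \<le> (a + b) powr q"
      using 3 by (simp add: pos_divide_le_eq)
    then show ?thesis
      using ab by (simp add: lp_norm_le_iff[OF q0] flip: a_def b_def)
  qed
qed

lemma lp_norm_diff_triangle: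
  assumes "1 < q"
  shows "lp_norm (ereal q) d (\<lambda>i. x i - z i) \<le> lp_norm (ereal q) d (\<lambda>i. x i - y i) + lp_norm (ereal q) d (\<lambda>i. y i - z i)"
  using lp_norm_triangle[OF assms, of d "\<lambda>i. x i - y i" "\<lambda>i. y i - z i"] by simp

text \<open>The crude factor \<open>d\<close> in place of d^(1/q) is independent of
  \<open>q\<close>; in the query counts it appears only under a logarithm.\<close>

lemma lp_norm_le_dim:
  assumes "1 \<le> q" "0 \<le> c" "\<And>i. i < d \<Longrightarrow> \<bar>x i\<bar> \<le> c"
  shows "lp_norm (ereal q) d x \<le> d * c"
proof (cases "d = 0")
  case True
  then show ?thesis by (simp add: lp_norm_ereal)
next
  case False
  have "(\<Sum>i<d. \<bar>x i\<bar> powr q) \<le> (\<Sum>i<d. c powr q)"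
    using assms by (intro sum_mono powr_mono2) auto
  also have "\<dots> = d powr 1 * c powr q"
    using False by simp
  also have "\<dots> \<le> d powr q * c powr q"
    using False assms by (intro mult_right_mono powr_mono) auto
  also have "\<dots> = (d * c) powr q"
    using assms by (simp add: powr_mult)
  finally show ?thesis
    using assms by (subst lp_norm_le_iff) auto
qed

text \<open>The tangent inequality at \<open>x i - z i\<close>, summed over the coordinates. It
  justifies the refutation of \<open>z\<close> by an answer \<open>y\<close> to the query
  \<open>x\<close>: a contraction towards a fixpoint near \<open>z\<close> would have come closer to
  \<open>z\<close>.\<close>

lemma lp_norm_le_of_gradient:
  assumes "1 < q" "0 \<le> (\<Sum>i<d. signed_powr (q - 1) (x i - z i) * (y i - x i))"
  shows "lp_norm (ereal q) d (\<lambda>i. x i - z i) \<le> lp_norm (ereal q) d (\<lambda>i. y i - z i)"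
proof -
  have "(\<Sum>i<d. \<bar>x i - z i\<bar> powr q)
      \<le> (\<Sum>i<d. \<bar>x i - z i\<bar> powr q) + q * (\<Sum>i<d. signed_powr (q - 1) (x i - z i) * (y i - x i))"
    using assms by simp
  also have "\<dots> = (\<Sum>i<d. \<bar>x i - z i\<bar> powr q + q * (signed_powr (q - 1) (x i - z i) * ((y i - z i) - (x i - z i))))"
    by (simp add: sum.distrib sum_distrib_left)
  also have "\<dots> \<le> (\<Sum>i<d. \<bar>y i - z i\<bar> powr q)"
    using assms(1) by (intro sum_mono abs_powr_tangent)
  finally show ?thesis
    using assms(1) by (simp add: lp_norm_le_iff lp_norm_powr)
qed

subsection \<open>Query algorithms\<close>

lemma funpow_in_cube:
  assumes "f \<in> cube d \<rightarrow> cube d" "x \<in> cube d"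
  shows "(f ^^ n) x \<in> cube d"
  using assms by (induction n) auto

lemma funpow_step_le:
  assumes q: "1 \<le> q" and lam: "0 \<le> lam" and f: "f \<in> cube d \<rightarrow> cube d"
    and contr: "contracting (ereal q) d lam f" and x: "x \<in> cube d"
  shows "lp_norm (ereal q) d (\<lambda>i. f ((f ^^ n) x) i - (f ^^ n) x i) \<le> lam ^ n * d"
proof (induction n)
  case 0
  have "\<bar>f x i - x i\<bar> \<le> 1" if "i < d" for i
    using cube_memD(1,2)[OF x that] cube_memD(1,2)[OF funcset_mem[OF f x] that] by linarith
  then show ?case
    using lp_norm_le_dim[of q 1 d "\<lambda>i. f x i - x i"] q by simp
next
  case (Suc n)
  let ?y = "(f ^^ n) x"
  have y: "?y \<in> cube d" "f ?y \<in> cube d"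
    using funpow_in_cube[OF f x, of n] f by auto
  have "lp_norm (ereal q) d (\<lambda>i. f (f ?y) i - f ?y i) \<le> lam * lp_norm (ereal q) d (\<lambda>i. f ?y i - ?y i)"
    using contr y by (simp add: contracting_def)
  also have "\<dots> \<le> lam * (lam ^ n * d)"
    using Suc.IH lam by (rule mult_left_mono)
  finally show ?case by (simp add: mult.assoc)
qed

primrec iterate_alg :: "nat \<Rightarrow> 'a \<Rightarrow> 'a query_alg" where
  "iterate_alg 0 x = Return x"
| "iterate_alg (Suc n) x = Query x (iterate_alg n)"

lemma result_iterate_alg: "result f (iterate_alg n x) = (f ^^ n) x"
  by (induction n arbitrary: x) (simp_all add: funpow_swap1)

lemma length_queries_iterate_alg: "length (queries f (iterate_alg n x)) = n"
  by (induction n arbitrary: x) simp_all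

lemma queries_iterate_alg_in_cube:
  assumes "f \<in> cube d \<rightarrow> cube d" "x \<in> cube d"
  shows "set (queries f (iterate_alg n x)) \<subseteq> cube d"
  using assms(2)
proof (induction n arbitrary: x)
  case (Suc n)
  then have "f x \<in> cube d" using assms(1) by auto
  then show ?case using Suc by simp
qed simp

section \<open>The grid of candidates and its unrefutable point\<close>

definition grid :: "nat \<Rightarrow> nat \<Rightarrow> (nat \<Rightarrow> real) set" where
  "grid N d = {..<d} \<rightarrow>\<^sub>E (\<lambda>k. real k / real N) ` {..N}"

lemma finite_grid: "finite (grid N d)"
  by (simp add: grid_def finite_PiE)

lemma grid_subset_cube: "grid N d \<subseteq> cube d"
  unfolding grid_def cube_def by (rule PiE_mono) (auto simp: divide_le_eq_1)

lemma card_grid_le: "card (grid N d) \<le> (N + 1) ^ d"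
proof -
  have "card ((\<lambda>k. real k / real N) ` {..N}) \<le> N + 1"
    using card_image_le[of "{..N}" "\<lambda>k. real k / real N"] by simp
  then show ?thesis
    by (simp add: grid_def card_PiE power_mono)
qed

lemma grid_near:
  assumes "0 < N" "x \<in> cube d"
  obtains g where "g \<in> grid N d" "\<forall>i<d. \<bar>x i - g i\<bar> \<le> 1 / N"
proof -
  define k where "k i = nat \<lfloor>real N * x i\<rfloor>" for i
  define g where "g = (\<lambda>i\<in>{..<d}. real (k i) / real N)"
  have bnd: "real (k i) \<le> N * x i" "N * x i \<le> real (k i) + 1" "k i \<le> N" if "i < d" for i
  proof -
    have x: "0 \<le> x i" "x i \<le> 1" using cube_memD(1,2)[OF assms(2) that] by auto
    then have "0 \<le> real N * x i" by simp
    then show 1: "real (k i) \<le> N * x i" "N * x i \<le> real (k i) + 1"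
      unfolding k_def by linarith+
    have "N * x i \<le> N" using x by (simp add: mult_left_le)
    with 1 show "k i \<le> N" by linarith
  qed
  have "g \<in> grid N d"
    unfolding grid_def g_def using bnd(3) by (intro restrict_PiE_iff[THEN iffD2]) auto
  moreover have "\<bar>x i - g i\<bar> \<le> 1 / N" if i: "i < d" for i
  proof -
    have "\<bar>x i - g i\<bar> = \<bar>real N * x i - real (k i)\<bar> / N"
      using i assms(1) by (simp add: g_def diff_divide_distrib abs_div_pos)
    also have "\<dots> \<le> 1 / N"
      using bnd[OF i] by (intro divide_right_mono) auto
    finally show ?thesis .
  qed
  ultimately show thesis using that by simp
qed

text \<open>Quantifying over all points of the cube, and not over those queried, makes the notion
  independent of the run: whatever is queried before an approximate fixpoint is met,
  \<open>g\<close> is not discarded.\<close>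

definition survivor ::
    "ereal \<Rightarrow> nat \<Rightarrow> real \<Rightarrow> ((nat \<Rightarrow> real) \<Rightarrow> (nat \<Rightarrow> real)) \<Rightarrow> (nat \<Rightarrow> real) \<Rightarrow> bool" where
  "survivor p d eps f g \<longleftrightarrow> (\<forall>x\<in>cube d. \<not> approx_fixpoint p d eps f x \<longrightarrow>
     lp_norm p d (\<lambda>i. f x i - g i) < lp_norm p d (\<lambda>i. x i - g i))"

text \<open>A late Banach iterate \<open>x'\<close> stands in for the fixpoint, and \<open>g\<close>
  is a grid point next to it. A point that is not an approximate fixpoint is far from
  \<open>x'\<close>, so the gain of the contraction exceeds the errors made in passing to
  \<open>g\<close>.\<close>

lemma grid_survivor:
  assumes q: "1 < q" and eps: "0 < eps" and lam: "0 \<le> lam" "lam < 1"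
    and f: "f \<in> cube d \<rightarrow> cube d" and contr: "contracting (ereal q) d lam f"
    and N: "0 < N" "8 * real d \<le> N * ((1 - lam) * eps)"
  shows "\<exists>g\<in>grid N d. survivor (ereal q) d eps f g"
proof -
  let ?n = "\<lambda>x y. lp_norm (ereal q) d (\<lambda>i. x i - y i)"
  have tri: "?n x z \<le> ?n x y + ?n y z" for x y z
    by (rule lp_norm_diff_triangle[OF q])
  \<comment> \<open>The errors add up to \<open>3 * \<delta>\<close>: two from moving
    \<open>f x'\<close> to \<open>x'\<close> and \<open>x'\<close> to \<open>g\<close>, and one from
    comparing \<open>x\<close> with \<open>g\<close>. The distance from \<open>x\<close> to
    \<open>x'\<close> exceeds \<open>eps * (7 / 16)\<close>, and 3/8 < 7/16.\<close>
  define \<delta> where "\<delta> = (1 - lam) * eps / 8"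
  have \<delta>: "0 < \<delta>" using eps lam by (simp add: \<delta>_def)
  have x0: "(\<lambda>i\<in>{..<d}. 0) \<in> cube d" by (auto simp: cube_def)
  \<comment> \<open>Dividing by \<open>d + 1\<close> rather than \<open>d\<close> covers
    \<open>d = 0\<close>.\<close>
  obtain n where n: "lam ^ n < \<delta> / (d + 1)"
    using real_arch_pow_inv[of "\<delta> / (d + 1)" lam] \<delta> lam by auto
  define x' where "x' = (f ^^ n) (\<lambda>i\<in>{..<d}. 0)"
  have x': "x' \<in> cube d" unfolding x'_def by (rule funpow_in_cube[OF f x0])
  have "?n (f x') x' \<le> lam ^ n * d"
    unfolding x'_def using q by (intro funpow_step_le[OF _ lam(1) f contr x0]) simp
  also have "\<dots> \<le> lam ^ n * (d + 1)"
    using lam by (intro mult_left_mono) auto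
  also have "\<dots> \<le> \<delta>" using n by (simp add: field_simps)
  finally have fx': "?n (f x') x' \<le> \<delta>" .
  obtain g where g: "g \<in> grid N d" "\<forall>i<d. \<bar>x' i - g i\<bar> \<le> 1 / N"
    by (rule grid_near[OF N(1) x'])
  have "?n x' g \<le> d * (1 / N)"
    using g q by (intro lp_norm_le_dim) auto
  also have "\<dots> \<le> \<delta>" using N by (simp add: \<delta>_def field_simps)
  finally have x'g: "?n x' g \<le> \<delta>" .
  have "?n (f x) g < ?n x g" if x: "x \<in> cube d" and not: "\<not> approx_fixpoint (ereal q) d eps f x" for x
  proof -
    have "eps < ?n (f x) x"
      using not x by (simp add: approx_fixpoint_def)
    moreover have "?n (f x) (f x') \<le> lam * ?n x x'"
      using contr x x' by (simp add: contracting_def)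
    moreover have "?n (f x) x' \<le> ?n (f x) (f x') + ?n (f x') x'"
      by (rule tri)
    moreover have "?n (f x) x \<le> ?n (f x) x' + ?n x' x" "?n x' x = ?n x x'"
      by (rule tri) (rule lp_norm_minus_commute)
    moreover have "lam * ?n x x' \<le> 1 * ?n x x'"
      using lam by (intro mult_right_mono) auto
    ultimately have big: "eps - \<delta> < 2 * ?n x x'" and fxx': "?n (f x) x' \<le> lam * ?n x x' + \<delta>"
      using fx' by linarith+
    have "?n (f x) g \<le> lam * ?n x x' + 2 * \<delta>"
      using tri[of "f x" g x'] fxx' x'g by linarith
    moreover have "?n x x' - \<delta> \<le> ?n x g"
      using tri[of x x' g] x'g lp_norm_minus_commute[of "ereal q" d x' g] by linarith
    moreover have "3 * \<delta> < (1 - lam) * ?n x x'"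
    proof -
      have "\<delta> \<le> eps / 8"
        using eps lam by (simp add: \<delta>_def field_simps)
      then have "eps * (7 / 16) < ?n x x'"
        using big by simp
      then have "(1 - lam) * (eps * (7 / 16)) < (1 - lam) * ?n x x'"
        using lam by (intro mult_strict_left_mono) auto
      moreover have "3 * \<delta> < (1 - lam) * (eps * (7 / 16))"
        using eps lam by (simp add: \<delta>_def)
      ultimately show ?thesis by linarith
    qed
    ultimately show ?thesis
      by (simp add: left_diff_distrib)
  qed
  then show ?thesis
    using g(1) unfolding survivor_def by blast
qed

section \<open>Discarding candidates at centerpoints\<close>

definition solves_within ::
    "ereal \<Rightarrow> nat \<Rightarrow> real \<Rightarrow> nat \<Rightarrow> ((nat \<Rightarrow> real) \<Rightarrow> (nat \<Rightarrow> real)) \<Rightarrow> (nat \<Rightarrow> real) query_alg \<Rightarrow> bool" where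
  "solves_within p d eps n f A \<longleftrightarrow> set (queries f A) \<subseteq> cube d \<and>
     approx_fixpoint p d eps f (result f A) \<and> length (queries f A) \<le> n"

text \<open>The candidates kept are those strictly closer to the answer \<open>y\<close> than to the
  query \<open>c\<close>. By the gradient inequality they avoid the set \<open>H\<close> of
  candidates refuted in direction \<open>y - c\<close>, which makes up at least
  \<open>1 / (d + 1)\<close> of \<open>Z\<close>.\<close>

lemma centerpoint_discards:
  assumes q: "1 < q" and Z: "finite Z" "Z \<subseteq> cube d"
  obtains c where "c \<in> cube d"
    and "\<forall>y. real (card {z \<in> Z. lp_norm (ereal q) d (\<lambda>i. y i - z i) < lp_norm (ereal q) d (\<lambda>i. c i - z i)})
      \<le> card Z * (real d / (real d + 1))"
proof -
  have cont: "continuous_on UNIV (signed_powr (q - 1))"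
    using q by (intro continuous_on_signed_powr) simp
  have pos: "0 \<le> signed_powr (q - 1) t" if "0 \<le> t" for t
    using that by (simp add: signed_powr_def)
  have neg: "signed_powr (q - 1) t \<le> 0" if "t \<le> 0" for t
    using that by (auto simp: signed_powr_def sgn_if)
  obtain c where c: "c \<in> cube d"
    and deep: "\<forall>v. card Z \<le> (d + 1) * card {z \<in> Z. 0 \<le> (\<Sum>i<d. signed_powr (q - 1) (c i - z i) * v i)}"
    by (rule nonlinear_centerpoint[OF cont pos neg Z])
  show thesis
  proof (rule that[OF c], rule allI)
    fix y
    define H where "H = {z \<in> Z. 0 \<le> (\<Sum>i<d. signed_powr (q - 1) (c i - z i) * (y i - c i))}"
    define K where "K = {z \<in> Z. lp_norm (ereal q) d (\<lambda>i. y i - z i) < lp_norm (ereal q) d (\<lambda>i. c i - z i)}"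
    have "K \<inter> H = {}"
    proof (rule equals0I)
      fix z assume "z \<in> K \<inter> H"
      then show False
        using lp_norm_le_of_gradient[OF q, where d=d and x=c and z=z and y=y] by (simp add: H_def K_def)
    qed
    then have "card K + card H = card (K \<union> H)"
      using Z by (intro card_Un_disjoint[symmetric]) (auto simp: H_def K_def)
    also have "\<dots> \<le> card Z"
      using Z by (intro card_mono) (auto simp: H_def K_def)
    finally have 1: "real (card K) + real (card H) \<le> card Z"
      by linarith
    have "real (card Z) \<le> real ((d + 1) * card H)"
      unfolding H_def using deep[rule_format, of "\<lambda>i. y i - c i"] by (rule of_nat_mono)
    then have 2: "real (card Z) \<le> (d + 1) * real (card H)"
      by (simp only: of_nat_mult)
    have "(d + 1) * real (card K) + (d + 1) * real (card H) \<le> (d + 1) * real (card Z)"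
      using mult_left_mono[OF 1, of "real (d + 1)"] by (simp only: distrib_left of_nat_0_le_iff)
    with 2 have "(d + 1) * real (card K) \<le> d * real (card Z)"
      by (simp add: algebra_simps)
    then have "real (card K) \<le> card Z * (real d / (real d + 1))"
      by (simp add: field_simps)
    then show "real (card {z \<in> Z. lp_norm (ereal q) d (\<lambda>i. y i - z i) < lp_norm (ereal q) d (\<lambda>i. c i - z i)})
        \<le> card Z * (real d / (real d + 1))"
      unfolding K_def .
  qed
qed

text \<open>Each query at a centerpoint either meets an approximate fixpoint or shrinks the
  candidates by the factor \<open>d / (d + 1)\<close> without losing the survivor.\<close>

lemma centerpoint_algorithm:
  assumes q: "1 < q"
    and "finite Z" "Z \<subseteq> cube d" "real (card Z) * (real d / (real d + 1)) ^ n < 1"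
  shows "\<exists>A. \<forall>f. f \<in> cube d \<rightarrow> cube d \<longrightarrow> (\<exists>g\<in>Z. survivor (ereal q) d eps f g) \<longrightarrow>
    solves_within (ereal q) d eps n f A"
  using assms(2-)
proof (induction n arbitrary: Z)
  case 0
  \<comment> \<open>With no queries left the cardinality is below 1, so there is no survivor and
    nothing has to be solved.\<close>
  then have "Z = {}" by simp
  then show ?case by simp
next
  case (Suc n)
  obtain c where c: "c \<in> cube d"
    and disc: "\<forall>y. real (card {z \<in> Z. lp_norm (ereal q) d (\<lambda>i. y i - z i) < lp_norm (ereal q) d (\<lambda>i. c i - z i)})
      \<le> card Z * (real d / (real d + 1))"
    by (rule centerpoint_discards[OF q Suc.prems(1,2)])
  \<comment> \<open>The candidates kept depend on \<open>f\<close> only through the answer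
    \<open>y\<close>, as the subtrees of a decision tree must.\<close>
  define Z' where "Z' y = {z \<in> Z. lp_norm (ereal q) d (\<lambda>i. y i - z i) < lp_norm (ereal q) d (\<lambda>i. c i - z i)}" for y
  have "\<exists>B. \<forall>f. f \<in> cube d \<rightarrow> cube d \<longrightarrow> (\<exists>g\<in>Z' y. survivor (ereal q) d eps f g) \<longrightarrow>
      solves_within (ereal q) d eps n f B" for y
  proof (rule Suc.IH)
    show "finite (Z' y)" "Z' y \<subseteq> cube d"
      using Suc.prems by (auto simp: Z'_def)
    have "real (card (Z' y)) * (real d / (real d + 1)) ^ n \<le> (card Z * (real d / (real d + 1))) * (real d / (real d + 1)) ^ n"
      unfolding Z'_def by (intro mult_right_mono disc[rule_format]) simp
    also have "\<dots> < 1"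
      using Suc.prems(3) by (simp only: power_Suc mult.assoc)
    finally show "real (card (Z' y)) * (real d / (real d + 1)) ^ n < 1" .
  qed
  then obtain B where B: "\<And>y f. f \<in> cube d \<rightarrow> cube d \<Longrightarrow> \<exists>g\<in>Z' y. survivor (ereal q) d eps f g \<Longrightarrow>
      solves_within (ereal q) d eps n f (B y)"
    by metis
  define A where "A = Query c (\<lambda>y. if lp_norm (ereal q) d (\<lambda>i. y i - c i) \<le> eps then Return c else B y)"
  have "solves_within (ereal q) d eps (Suc n) f A"
    if f: "f \<in> cube d \<rightarrow> cube d" and g: "g \<in> Z" "survivor (ereal q) d eps f g" for f g
  proof (cases "approx_fixpoint (ereal q) d eps f c")
    case True
    then show ?thesis
      using c by (simp add: A_def solves_within_def approx_fixpoint_def)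
  next
    case False
    then have "g \<in> Z' (f c)"
      using g c by (simp add: survivor_def Z'_def)
    then have "solves_within (ereal q) d eps n f (B (f c))"
      using B[OF f] g(2) by blast
    then show ?thesis
      using False c by (simp add: A_def solves_within_def approx_fixpoint_def)
  qed
  then show ?case by blast
qed

subsection \<open>Counting queries\<close>

lemma ln_le_log2:
  assumes "1 \<le> x"
  shows "ln x \<le> log 2 x"
proof -
  have "0 \<le> ln x" "0 < ln (2::real)" "ln (2::real) \<le> 1"
    using assms ln_le_minus_one[of "2::real"] by simp_all
  then show ?thesis
    by (simp add: log_def pos_le_divide_eq mult_left_le)
qed

lemma solves_within_mono:
  assumes "solves_within p d e n f A" "e \<le> eps" "n \<le> m"
  shows "solves_within p d eps m f A"
  using assms by (auto simp: solves_within_def approx_fixpoint_def)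

text \<open>Here \<open>1 / (1 - lam) < d\<close>, so Banach iteration needs about d ln(d / e)
  steps, and ln d \<le> d is absorbed by the second factor \<open>d\<close>.\<close>

lemma lq_iteration_algorithm:
  assumes q: "1 < q" and e: "0 < e" "e \<le> 1" and lam: "0 \<le> lam" "lam < 1" and d: "1 < real d * (1 - lam)"
    and M: "1 \<le> M" "ln (1 / e) \<le> M"
  shows "\<exists>A n. real n \<le> 3 * (real d)\<^sup>2 * M \<and> (\<forall>f. f \<in> cube d \<rightarrow> cube d \<longrightarrow>
    contracting (ereal q) d lam f \<longrightarrow> solves_within (ereal q) d e n f A)"
proof -
  have d0: "1 \<le> real d" using d lam by (cases d) auto
  \<comment> \<open>From \<open>1 / d < 1 - lam\<close> it follows that lam^n \<le> exp(-n (1 -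
    lam)) \<le> e / d, while the first step has length at most \<open>d\<close>.\<close>
  define n where "n = nat \<lceil>d * ln (d / e)\<rceil>"
  have lnd: "0 \<le> ln (d / e)" using d0 e by (simp add: ln_ge_zero_iff)
  have n_ge: "d * ln (d / e) \<le> n" unfolding n_def by linarith
  have "real n \<le> d * ln (d / e) + 1"
    unfolding n_def using lnd mult_nonneg_nonneg[of "real d" "ln (d / e)"] by simp
  also have "ln (d / e) = ln d + ln (1 / e)"
    using d0 e by (simp add: ln_div)
  also have "d * (ln d + ln (1 / e)) + 1 \<le> d * (d + M) + 1"
    using d0 M ln_le_minus_one[of "real d"] by (intro add_right_mono mult_left_mono add_mono) auto
  also have "\<dots> \<le> 3 * (real d)\<^sup>2 * M"
  proof -
    have d2: "1 \<le> (real d)\<^sup>2" "real d \<le> (real d)\<^sup>2"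
      using d0 by (auto simp: power2_eq_square intro: order_trans[OF d0])
    have "real d * M \<le> (real d)\<^sup>2 * M" "(real d)\<^sup>2 * 1 \<le> (real d)\<^sup>2 * M"
      using d2 M by (intro mult_right_mono mult_left_mono; simp)+
    with d2 show ?thesis by (simp add: distrib_left power2_eq_square)
  qed
  finally have n_le: "real n \<le> 3 * (real d)\<^sup>2 * M" .
  have "lam \<le> exp (- (1 - lam))"
    using exp_ge_add_one_self[of "- (1 - lam)"] by simp
  then have "lam ^ n \<le> exp (- (1 - lam)) ^ n"
    using lam by (intro power_mono)
  also have "\<dots> = exp (- (n * (1 - lam)))"
    by (simp add: algebra_simps flip: exp_of_nat_mult)
  also have "\<dots> \<le> exp (- ln (d / e))"
  proof -
    have "1 * ln (d / e) \<le> (d * (1 - lam)) * ln (d / e)"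
      using d lnd by (intro mult_right_mono) auto
    also have "\<dots> \<le> n * (1 - lam)"
      using mult_right_mono[OF n_ge, of "1 - lam"] lam by (simp add: mult_ac)
    finally show ?thesis by simp
  qed
  also have "\<dots> = e / d"
    using d0 e by (simp add: exp_minus)
  finally have small: "lam ^ n * d \<le> e"
    using d0 by (simp add: field_simps)
  have x0: "(\<lambda>i\<in>{..<d}. 0) \<in> cube d" by (auto simp: cube_def)
  have "solves_within (ereal q) d e n f (iterate_alg n (\<lambda>i\<in>{..<d}. 0))"
    if f: "f \<in> cube d \<rightarrow> cube d" and contr: "contracting (ereal q) d lam f" for f
    unfolding solves_within_def approx_fixpoint_def result_iterate_alg length_queries_iterate_alg
    using q small
    by (intro conjI order_refl queries_iterate_alg_in_cube[OF f x0] funpow_in_cube[OF f x0]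
        order_trans[OF funpow_step_le[OF _ lam(1) f contr x0]]) auto
  then show ?thesis using n_le by blast
qed

text \<open>The at most (N + 1)^d grid points are exhausted after about d (d + 1) ln(N + 1) queries,
  since d / (d + 1) \<le> exp(-1 / (d + 1)).\<close>

lemma lq_centerpoint_algorithm:
  assumes q: "1 < q" and e: "0 < e" "e \<le> 1" and lam: "0 \<le> lam" "lam < 1"
    and d: "0 < d" "real d * (1 - lam) \<le> 1"
    and M: "1 \<le> M" "ln (1 / e) \<le> M" and L: "ln (1 / (1 - lam)) \<le> L"
  shows "\<exists>A n. real n \<le> 11 * (real d)\<^sup>2 * (M + L) \<and> (\<forall>f. f \<in> cube d \<rightarrow> cube d \<longrightarrow>
    contracting (ereal q) d lam f \<longrightarrow> solves_within (ereal q) d e n f A)"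
proof -
  have d1: "1 \<le> real d" using d by simp
  define N where "N = nat \<lceil>8 * d / ((1 - lam) * e)\<rceil>"
  have pos: "0 < (1 - lam) * e" "(1 - lam) * e \<le> 1"
    using e lam by (auto intro: mult_le_one)
  have N_ge: "8 * d / ((1 - lam) * e) \<le> N" unfolding N_def by linarith
  then have N8: "8 * real d \<le> N * ((1 - lam) * e)"
    using pos by (simp add: pos_divide_le_eq)
  then have N0: "0 < N" using d1 by (cases N) auto
  \<comment> \<open>The summand 1 makes the final inequality \<open>< 1\<close> strict.\<close>
  define n where "n = nat \<lfloor>(real d + 1) * (d * ln (real N + 1))\<rfloor> + 1"
  have lnN: "0 \<le> ln (real N + 1)" by simp
  have L0: "0 \<le> L" using L lam by (intro order_trans[OF _ L]) simp
  have "ln (real N + 1) \<le> 5 * (M + L)"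
  proof -
    have big: "1 \<le> d / ((1 - lam) * e)"
      using d1 pos by (simp add: pos_le_divide_eq)
    have "0 \<le> 8 * d / ((1 - lam) * e)" using pos by simp
    then have "real N + 1 \<le> 8 * d / ((1 - lam) * e) + 2"
      unfolding N_def by linarith
    also have "\<dots> \<le> 16 * (d / ((1 - lam) * e))" using big by simp
    \<comment> \<open>The hypothesis \<open>d * (1 - lam) \<le> 1\<close> trades the factor
      \<open>d\<close> for \<open>1 / (1 - lam)\<close>, so that no ln d remains.\<close>
    also have "\<dots> \<le> 16 * ((1 / (1 - lam)) / ((1 - lam) * e))"
      using d lam pos by (intro mult_left_mono divide_right_mono) (auto simp: pos_le_divide_eq)
    also have "\<dots> = 2 ^ 4 * ((1 / (1 - lam)) ^ 2 * (1 / e))"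
      using lam e by (simp add: power2_eq_square)
    finally have "ln (real N + 1) \<le> ln (2 ^ 4 * ((1 / (1 - lam)) ^ 2 * (1 / e)))"
      by (intro ln_mono) auto
    also have "\<dots> = 4 * ln 2 + (2 * ln (1 / (1 - lam)) + ln (1 / e))"
    proof -
      have *: "ln (2 ^ 4 * (a ^ 2 * b)) = 4 * ln 2 + (2 * ln a + ln b)" if "0 < a" "0 < b" for a b :: real
      proof -
        have "ln (2 ^ 4 * (a ^ 2 * b)) = ln (2 ^ 4) + (ln (a ^ 2) + ln b)"
          using that by (simp only: ln_mult_pos mult_pos_pos zero_less_power zero_less_numeral)
        then show ?thesis
          using that ln_realpow[of 2 4] by (simp add: ln_realpow)
      qed
      show ?thesis using lam e by (intro *) auto
    qed
    also have "\<dots> \<le> 4 * 1 + (2 * L + M)"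
      using M L ln_le_minus_one[of "2::real"] by (intro add_mono mult_left_mono) auto
    also have "\<dots> \<le> 5 * (M + L)" using M L0 by simp
    finally show ?thesis .
  qed
  moreover have "real n \<le> (real d + 1) * (d * ln (real N + 1)) + 1"
    unfolding n_def using lnN d1 by (simp add: of_nat_floor)
  moreover have "(real d + 1) * (d * ln (real N + 1)) \<le> (2 * real d) * (d * ln (real N + 1))"
    using d1 lnN by (intro mult_right_mono) auto
  ultimately have "real n \<le> 2 * (real d)\<^sup>2 * (5 * (M + L)) + 1"
    using mult_left_mono[of "ln (real N + 1)" "5 * (M + L)" "2 * (real d)\<^sup>2"]
    by (simp add: power2_eq_square mult_ac add_ac)
  also have "\<dots> \<le> 11 * (real d)\<^sup>2 * (M + L)"
  proof -
    have "1 * 1 \<le> (real d)\<^sup>2 * (M + L)"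
      using d1 M L0 by (intro mult_mono) auto
    then show ?thesis by (simp add: algebra_simps)
  qed
  finally have n_le: "real n \<le> 11 * (real d)\<^sup>2 * (M + L)" .
  have "real (card (grid N d)) * (real d / (real d + 1)) ^ n \<le> (real N + 1) ^ d * exp (- 1 / (real d + 1)) ^ n"
  proof (intro mult_mono power_mono)
    have "real (card (grid N d)) \<le> real ((N + 1) ^ d)"
      using card_grid_le by (rule of_nat_mono)
    then show "real (card (grid N d)) \<le> (real N + 1) ^ d" by (simp add: add.commute)
    have "real d / (real d + 1) = 1 + (- 1 / (real d + 1))"
      by (simp add: field_simps)
    then show "real d / (real d + 1) \<le> exp (- 1 / (real d + 1))"
      using exp_ge_add_one_self[of "- 1 / (real d + 1)"] by simp
  qed auto
  also have "\<dots> = exp (d * ln (real N + 1) - n / (real d + 1))"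
  proof -
    have "(real N + 1) ^ d = exp (d * ln (real N + 1))"
      by (simp add: exp_of_nat_mult)
    moreover have "exp (- 1 / (real d + 1)) ^ n = exp (- (n / (real d + 1)))"
      by (simp flip: exp_of_nat_mult)
    ultimately show ?thesis by (simp flip: exp_add)
  qed
  also have "\<dots> < 1"
  proof -
    have "(real d + 1) * (d * ln (real N + 1)) < n"
      unfolding n_def by linarith
    then have "d * ln (real N + 1) < n / (real d + 1)"
      by (simp add: pos_less_divide_eq mult.commute)
    then show ?thesis by simp
  qed
  finally obtain A where A: "\<forall>f. f \<in> cube d \<rightarrow> cube d \<longrightarrow> (\<exists>g\<in>grid N d. survivor (ereal q) d e f g) \<longrightarrow>
      solves_within (ereal q) d e n f A"
    using centerpoint_algorithm[OF q finite_grid grid_subset_cube] by blast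
  have "solves_within (ereal q) d e n f A"
    if "f \<in> cube d \<rightarrow> cube d" "contracting (ereal q) d lam f" for f
    using A grid_survivor[OF q e(1) lam that N0 N8] that by blast
  then show ?thesis using n_le by blast
qed

lemma lq_algorithm:
  assumes q: "1 < q" and eps: "0 < eps" and lam: "0 \<le> lam" "lam < 1" and d: "0 < d"
  shows "\<exists>A n. real n \<le> 11 * (real d)\<^sup>2 * (max 1 (log 2 (1 / eps)) + log 2 (1 / (1 - lam))) \<and>
    (\<forall>f. f \<in> cube d \<rightarrow> cube d \<longrightarrow> contracting (ereal q) d lam f \<longrightarrow> solves_within (ereal q) d eps n f A)"
proof -
  \<comment> \<open>For \<open>eps > 1\<close> the problem is solved to precision 1, which the
    \<open>max 1\<close> in the bound pays for.\<close>
  define e where "e = min eps 1"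
  define M where "M = max 1 (log 2 (1 / eps))"
  define L where "L = log 2 (1 / (1 - lam))"
  have e: "0 < e" "e \<le> 1" "e \<le> eps" using eps by (auto simp: e_def)
  have M: "1 \<le> M" "ln (1 / e) \<le> M"
  proof -
    show "1 \<le> M" by (simp add: M_def)
    show "ln (1 / e) \<le> M"
    proof (cases "eps \<le> 1")
      case True
      then show ?thesis using ln_le_log2[of "1 / eps"] eps by (simp add: e_def M_def)
    next
      case False
      then show ?thesis using \<open>1 \<le> M\<close> by (simp add: e_def)
    qed
  qed
  have L: "ln (1 / (1 - lam)) \<le> L"
    unfolding L_def using lam by (intro ln_le_log2) simp
  have L0: "0 \<le> L"
    unfolding L_def using lam by (intro zero_le_log_cancel_iff[THEN iffD2]) auto
  have "\<exists>A n. real n \<le> 11 * (real d)\<^sup>2 * (M + L) \<and>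
    (\<forall>f. f \<in> cube d \<rightarrow> cube d \<longrightarrow> contracting (ereal q) d lam f \<longrightarrow> solves_within (ereal q) d e n f A)"
  proof (cases "real d * (1 - lam) \<le> 1")
    case True
    then show ?thesis
      by (intro lq_centerpoint_algorithm q e lam d M L)
  next
    case False
    have "3 * (real d)\<^sup>2 * M \<le> 11 * (real d)\<^sup>2 * (M + L)"
      using M L0 by (intro mult_mono) auto
    moreover have "\<exists>A n. real n \<le> 3 * (real d)\<^sup>2 * M \<and>
      (\<forall>f. f \<in> cube d \<rightarrow> cube d \<longrightarrow> contracting (ereal q) d lam f \<longrightarrow> solves_within (ereal q) d e n f A)"
      using False by (intro lq_iteration_algorithm[OF q e(1,2) lam _ M]) simp
    ultimately show ?thesis by (meson order_trans)
  qed
  then show ?thesis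
    unfolding M_def L_def using solves_within_mono[OF _ e(3) order_refl] by blast
qed

subsection \<open>Passing to smooth norms\<close>

lemma lp_norm_one: "lp_norm (ereal 1) d x = (\<Sum>i<d. \<bar>x i\<bar>)"
  by (simp add: lp_norm_ereal sum_nonneg)

text \<open>Each |x_i| is at most the sum \<open>T\<close>, hence |x_i|^q \<le> |x_i| T^(q - 1), and
  these bounds add up to T^q.\<close>

lemma lp_norm_le_l1:
  assumes "1 < q"
  shows "lp_norm (ereal q) d x \<le> lp_norm (ereal 1) d x"
proof -
  define T where "T = lp_norm (ereal 1) d x"
  have T: "0 \<le> T" by (simp add: T_def)
  have split: "t powr q = t * t powr (q - 1)" if "0 \<le> t" for t :: real
    using that assms by (cases "t = 0") (simp_all add: powr_diff)
  have "(\<Sum>i<d. \<bar>x i\<bar> powr q) \<le> (\<Sum>i<d. \<bar>x i\<bar> * T powr (q - 1))"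
  proof (rule sum_mono)
    fix i assume "i \<in> {..<d}"
    then have "\<bar>x i\<bar> \<le> T"
      unfolding T_def lp_norm_one by (intro member_le_sum) auto
    then have "\<bar>x i\<bar> powr (q - 1) \<le> T powr (q - 1)"
      using assms by (intro powr_mono2) auto
    then show "\<bar>x i\<bar> powr q \<le> \<bar>x i\<bar> * T powr (q - 1)"
      by (simp add: split mult_left_mono)
  qed
  also have "\<dots> = T powr q"
    using T by (simp add: split T_def lp_norm_one sum_distrib_right)
  finally show ?thesis
    using assms T by (simp add: lp_norm_le_iff flip: T_def)
qed

text \<open>The power mean inequality, from the tangent at the mean \<open>m\<close> of the |x_i|,
  where the linear terms sum to 0.\<close>

lemma l1_le_lp_norm:
  assumes q: "1 < q" and d: "0 < d"
  shows "lp_norm (ereal 1) d x \<le> real d powr (1 - 1 / q) * lp_norm (ereal q) d x"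
proof -
  define T where "T = (\<Sum>i<d. \<bar>x i\<bar>)"
  define m where "m = T / d"
  have T: "0 \<le> T" by (simp add: T_def sum_nonneg)
  have m: "0 \<le> m" "d * m = T" using T d by (simp_all add: m_def)
  have "d * m powr q = (\<Sum>i<d. \<bar>m\<bar> powr q + q * (signed_powr (q - 1) m * (\<bar>x i\<bar> - m)))"
    using m by (simp add: sum.distrib sum_subtractf flip: sum_distrib_left T_def)
  also have "\<dots> \<le> (\<Sum>i<d. \<bar>\<bar>x i\<bar>\<bar> powr q)"
    by (intro sum_mono abs_powr_tangent q)
  also have "\<dots> = lp_norm (ereal q) d x powr q"
    using q by (simp add: lp_norm_powr)
  finally have "(d * m powr q) powr (1 / q) \<le> (lp_norm (ereal q) d x powr q) powr (1 / q)"
    using q by (intro powr_mono2) auto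
  then have le: "real d powr (1 / q) * m \<le> lp_norm (ereal q) d x"
    using q m by (simp add: powr_mult powr_powr)
  have "T = real d powr (1 - 1 / q) * (real d powr (1 / q) * m)"
    using m d by (simp flip: powr_add mult.assoc)
  also have "\<dots> \<le> real d powr (1 - 1 / q) * lp_norm (ereal q) d x"
    using le by (rule mult_left_mono) simp
  finally show ?thesis by (simp add: T_def lp_norm_one)
qed

lemma abs_le_linf: "i < d \<Longrightarrow> \<bar>x i\<bar> \<le> lp_norm \<infinity> d x"
  by (simp add: lp_norm_def)

lemma linf_nonneg: "0 \<le> lp_norm \<infinity> d x"
  by (simp add: lp_norm_def)

lemma lp_norm_le_linf:
  assumes "1 < q"
  shows "lp_norm (ereal q) d x \<le> real d powr (1 / q) * lp_norm \<infinity> d x"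
proof -
  have "(\<Sum>i<d. \<bar>x i\<bar> powr q) \<le> (\<Sum>i<d. lp_norm \<infinity> d x powr q)"
    using assms by (intro sum_mono powr_mono2) (auto simp: abs_le_linf)
  also have "\<dots> = (real d powr (1 / q) * lp_norm \<infinity> d x) powr q"
    using assms linf_nonneg[of d x] by (simp add: powr_mult powr_powr)
  finally show ?thesis
    using assms linf_nonneg[of d x] by (simp add: lp_norm_le_iff)
qed

lemma linf_le_lp_norm:
  assumes "1 < q"
  shows "lp_norm \<infinity> d x \<le> lp_norm (ereal q) d x"
proof -
  have "\<bar>x i\<bar> \<le> lp_norm (ereal q) d x" if "i < d" for i
  proof -
    have "\<bar>x i\<bar> powr q \<le> (\<Sum>i<d. \<bar>x i\<bar> powr q)"
      using that by (intro member_le_sum) auto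
    then have "(\<bar>x i\<bar> powr q) powr (1 / q) \<le> lp_norm (ereal q) d x"
      unfolding lp_norm_ereal using assms by (intro powr_mono2) auto
    then show ?thesis using assms by (simp add: powr_powr)
  qed
  then show ?thesis by (auto simp: lp_norm_def[of \<infinity>])
qed

text \<open>For \<open>p = \<infinity>\<close> and \<open>p = 1\<close> the exponents
  \<open>1 / s\<close> and \<open>1 / (1 - s)\<close> distort the norm by at most d^s, which is
  below \<kappa> for small \<open>s\<close>; any other \<open>p\<close> serves as its own
  \<open>q\<close>.\<close>

lemma lp_norm_almost_smooth:
  assumes p: "1 \<le> p" and \<kappa>: "1 < \<kappa>" and d: "0 < d"
  obtains q \<alpha> \<beta> where "1 < q" "1 \<le> \<alpha>" "1 \<le> \<beta>" "\<alpha> * \<beta> \<le> \<kappa>"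
    "\<forall>x. lp_norm (ereal q) d x \<le> \<alpha> * lp_norm p d x"
    "\<forall>x. lp_norm p d x \<le> \<beta> * lp_norm (ereal q) d x"
proof -
  have d1: "1 \<le> real d" using d by simp
  have ln: "0 \<le> ln (real d)" "0 < ln \<kappa>" using d1 \<kappa> by simp_all
  have le_\<kappa>: "real d powr s \<le> \<kappa>" if "s * (ln d + 1) \<le> ln \<kappa>" "0 \<le> s" for s
  proof -
    have "s * ln d \<le> s * (ln d + 1)"
      using that(2) by (intro mult_left_mono) auto
    then have "s * ln d \<le> ln \<kappa>" using that(1) by linarith
    then have "exp (s * ln d) \<le> exp (ln \<kappa>)" by simp
    then show ?thesis using d \<kappa> by (simp add: powr_def)
  qed
  \<comment> \<open>The bound \<open>1 / 2\<close> keeps both exponents finite and above 1;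
    \<open>ln d + 1\<close> in place of \<open>ln d\<close> is nonzero also for
    \<open>d = 1\<close>.\<close>
  define s where "s = min (1 / 2) (ln \<kappa> / (ln d + 1))"
  have s: "0 < s" "s < 1" "s * (ln d + 1) \<le> ln \<kappa>"
  proof -
    show "0 < s" "s < 1" using ln by (auto simp: s_def)
    have "s * (ln d + 1) \<le> (ln \<kappa> / (ln d + 1)) * (ln d + 1)"
      using ln by (intro mult_right_mono) (auto simp: s_def)
    then show "s * (ln d + 1) \<le> ln \<kappa>" using ln by simp
  qed
  have ds: "real d powr s \<le> \<kappa>" "1 \<le> real d powr s"
    using le_\<kappa>[of s] s d1 by (auto intro: ge_one_powr_ge_zero)
  consider "p = \<infinity>" | "p = ereal 1" | r where "p = ereal r" "1 < r"
  proof (cases p)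
    case (real r)
    then have "1 \<le> r" using p by (simp only: one_ereal_def ereal_less_eq)
    then show thesis using real that(2,3) by (cases "r = 1") simp_all
  qed (use p that(1) in simp_all)
  then show thesis
  proof cases
    case 1
    define q where "q = 1 / s"
    have q: "1 < q" "1 / q = s" using s by (auto simp: q_def)
    show thesis
    proof (rule that[OF q(1), of "real d powr s" 1])
      show "\<forall>x. lp_norm (ereal q) d x \<le> real d powr s * lp_norm p d x"
        using lp_norm_le_linf[OF q(1), of d] unfolding 1 q(2) by (rule allI)
      show "\<forall>x. lp_norm p d x \<le> 1 * lp_norm (ereal q) d x"
        using linf_le_lp_norm[OF q(1), of d] unfolding 1 mult_1 by (rule allI)
    qed (use ds in simp_all)
  next
    case 2
    define q where "q = 1 / (1 - s)"
    have q: "1 < q" "1 - 1 / q = s" using s by (auto simp: q_def)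
    show thesis
    proof (rule that[OF q(1), of 1 "real d powr s"])
      show "\<forall>x. lp_norm (ereal q) d x \<le> 1 * lp_norm p d x"
        using lp_norm_le_l1[OF q(1), of d] unfolding 2 mult_1 by (rule allI)
      show "\<forall>x. lp_norm p d x \<le> real d powr s * lp_norm (ereal q) d x"
        using l1_le_lp_norm[OF q(1) d] unfolding 2 q(2) by (rule allI)
    qed (use ds in simp_all)
  next
    case 3
    then show thesis
      using \<kappa> by (intro that[of r 1 1]) simp_all
  qed
qed

lemma contracting_change_norm:
  assumes contr: "contracting p d lam f" and lam: "0 \<le> lam" and \<alpha>: "0 \<le> \<alpha>"
    and le: "\<forall>x. lp_norm p' d x \<le> \<alpha> * lp_norm p d x" "\<forall>x. lp_norm p d x \<le> \<beta> * lp_norm p' d x"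
    and lam': "\<alpha> * \<beta> * lam \<le> lam'" and nonneg: "\<And>x. 0 \<le> lp_norm p' d x"
  shows "contracting p' d lam' f"
  unfolding contracting_def
proof (intro ballI)
  fix x y assume xy: "x \<in> cube d" "y \<in> cube d"
  have "lp_norm p' d (\<lambda>i. f x i - f y i) \<le> \<alpha> * lp_norm p d (\<lambda>i. f x i - f y i)"
    using le(1) by simp
  also have "\<dots> \<le> \<alpha> * (lam * lp_norm p d (\<lambda>i. x i - y i))"
    using contr xy \<alpha> by (intro mult_left_mono) (auto simp: contracting_def)
  also have "\<dots> \<le> \<alpha> * (lam * (\<beta> * lp_norm p' d (\<lambda>i. x i - y i)))"
    using le(2) \<alpha> lam by (intro mult_left_mono) auto
  also have "\<dots> = (\<alpha> * \<beta> * lam) * lp_norm p' d (\<lambda>i. x i - y i)"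
    by (simp add: mult_ac)
  also have "\<dots> \<le> lam' * lp_norm p' d (\<lambda>i. x i - y i)"
    using lam' nonneg by (rule mult_right_mono)
  finally show "lp_norm p' d (\<lambda>i. f x i - f y i) \<le> lam' * lp_norm p' d (\<lambda>i. x i - y i)" .
qed

lemma lp_algorithm:
  assumes p: "1 \<le> p" and eps: "0 < eps" and lam: "0 \<le> lam" "lam < 1"
  shows "\<exists>A n. real n \<le> 33 * (real d)\<^sup>2 * (max 1 (log 2 (1 / eps)) + log 2 (1 / (1 - lam))) \<and>
    (\<forall>f. f \<in> cube d \<rightarrow> cube d \<longrightarrow> contracting p d lam f \<longrightarrow> solves_within p d eps n f A)"
proof (cases "d = 0")
  case True
  \<comment> \<open>For \<open>d = 0\<close> the bound is 0, so no query may be made; the only point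
    of the cube is returned.\<close>
  have "solves_within p d eps 0 f (Return (\<lambda>_. undefined))" for f
    using True eps by (simp add: solves_within_def approx_fixpoint_def cube_def lp_norm_def)
  then show ?thesis
    using True by (intro exI[of _ "Return (\<lambda>_. undefined)"] exI[of _ 0]) simp
next
  case False
  then have d: "0 < d" by simp
  define lam' where "lam' = (1 + lam) / 2"
  have lam': "0 \<le> lam'" "lam' < 1" using lam by (auto simp: lam'_def)
  \<comment> \<open>A distortion of \<kappa> still leaves the contraction factor
    \<open>lam'\<close>, halfway between \<open>lam\<close> and 1.\<close>
  define \<kappa> where "\<kappa> = 1 + (1 - lam) / 2"
  have \<kappa>: "1 < \<kappa>" "\<kappa> \<le> 2" using lam by (auto simp: \<kappa>_def)
  have "(1 - lam) / 2 * lam \<le> (1 - lam) / 2 * 1"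
    using lam by (intro mult_left_mono) auto
  then have \<kappa>lam: "\<kappa> * lam \<le> lam'"
    by (simp add: \<kappa>_def lam'_def field_simps)
  obtain q \<alpha> \<beta> where q: "1 < q" and \<alpha>: "1 \<le> \<alpha>" and \<beta>: "1 \<le> \<beta>" and \<alpha>\<beta>: "\<alpha> * \<beta> \<le> \<kappa>"
    and le: "\<forall>x. lp_norm (ereal q) d x \<le> \<alpha> * lp_norm p d x" "\<forall>x. lp_norm p d x \<le> \<beta> * lp_norm (ereal q) d x"
    by (rule lp_norm_almost_smooth[OF p \<kappa>(1) d])
  have "1 * \<beta> \<le> \<alpha> * \<beta>" using \<alpha> \<beta> by (intro mult_right_mono) auto
  then have \<beta>2: "\<beta> \<le> 2" using \<alpha>\<beta> \<kappa> by simp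
  \<comment> \<open>Returning to the norm \<open>p\<close> costs a factor
    \<open>\<beta> \<le> 2\<close>, so half the precision is demanded.\<close>
  have "0 < eps / 2" using eps by simp
  from lq_algorithm[OF q this lam' d] obtain A n where
    n: "real n \<le> 11 * (real d)\<^sup>2 * (max 1 (log 2 (1 / (eps / 2))) + log 2 (1 / (1 - lam')))"
    and A: "\<forall>f. f \<in> cube d \<rightarrow> cube d \<longrightarrow> contracting (ereal q) d lam' f \<longrightarrow>
      solves_within (ereal q) d (eps / 2) n f A"
    by (elim exE conjE) (rule that)
  have "solves_within p d eps n f A" if f: "f \<in> cube d \<rightarrow> cube d" and contr: "contracting p d lam f" for f
  proof -
    have "\<alpha> * \<beta> * lam \<le> \<kappa> * lam"
      using \<alpha>\<beta> lam by (intro mult_right_mono)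
    then have "contracting (ereal q) d lam' f"
      using \<alpha> \<kappa>lam by (intro contracting_change_norm[OF contr lam(1) _ le]) auto
    then have "solves_within (ereal q) d (eps / 2) n f A"
      using A f by blast
    moreover have "lp_norm p d x \<le> eps" if "lp_norm (ereal q) d x \<le> eps / 2" for x
    proof -
      have "lp_norm p d x \<le> \<beta> * lp_norm (ereal q) d x" using le(2) by blast
      also have "\<dots> \<le> 2 * (eps / 2)"
        using that \<beta>2 by (intro mult_mono) auto
      finally show ?thesis by simp
    qed
    ultimately show ?thesis by (simp add: solves_within_def approx_fixpoint_def)
  qed
  moreover have "real n \<le> 33 * (real d)\<^sup>2 * (max 1 (log 2 (1 / eps)) + log 2 (1 / (1 - lam)))"
  proof -
    have "log 2 (1 / (eps / 2)) = 1 + log 2 (1 / eps)"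
      using eps log_mult[of 2 "1 / eps" 2] by simp
    moreover have "log 2 (1 / (1 - lam')) = 1 + log 2 (1 / (1 - lam))"
    proof -
      have "1 / (1 - lam') = 2 * (1 / (1 - lam))"
        using lam by (simp add: lam'_def field_simps)
      then show ?thesis
        using lam log_mult[of 2 "1 / (1 - lam)" 2] by simp
    qed
    moreover have "0 \<le> log 2 (1 / (1 - lam))"
      using lam by (intro zero_le_log_cancel_iff[THEN iffD2]) auto
    \<comment> \<open>Halving \<open>eps\<close> and halving \<open>1 - lam\<close> each add at most
      1, which is at most the \<open>max\<close> term; this gives the factor 3 and the constant
      33.\<close>
    ultimately have "max 1 (log 2 (1 / (eps / 2))) + log 2 (1 / (1 - lam'))
        \<le> 3 * (max 1 (log 2 (1 / eps)) + log 2 (1 / (1 - lam)))"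
      by (simp add: max_def)
    then have "11 * (real d)\<^sup>2 * (max 1 (log 2 (1 / (eps / 2))) + log 2 (1 / (1 - lam')))
        \<le> 11 * (real d)\<^sup>2 * (3 * (max 1 (log 2 (1 / eps)) + log 2 (1 / (1 - lam))))"
      by (intro mult_left_mono) auto
    also have "\<dots> = 33 * (real d)\<^sup>2 * (max 1 (log 2 (1 / eps)) + log 2 (1 / (1 - lam)))"
      by (simp add: algebra_simps)
    finally show ?thesis using n by (rule order_trans[rotated])
  qed
  ultimately show ?thesis by blast
qed

theorem theorem4p2:
  fixes p :: ereal
  assumes "1 \<le> p"
  shows "\<exists>(A :: nat \<Rightarrow> real \<Rightarrow> real \<Rightarrow> (nat \<Rightarrow> real) query_alg) (C :: real).
    \<forall>(d :: nat) (eps :: real) (lam :: real) (f :: (nat \<Rightarrow> real) \<Rightarrow> (nat \<Rightarrow> real)).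
      0 < eps \<longrightarrow> 0 \<le> lam \<longrightarrow> lam < 1 \<longrightarrow> f \<in> cube d \<rightarrow> cube d \<longrightarrow> contracting p d lam f \<longrightarrow>
        set (queries f (A d eps lam)) \<subseteq> cube d \<and>
        approx_fixpoint p d eps f (result f (A d eps lam)) \<and>
        real (length (queries f (A d eps lam)))
          \<le> C * (real d)\<^sup>2 * (max 1 (log 2 (1 / eps)) + log 2 (1 / (1 - lam)))"
proof -
  define good where "good d eps lam A \<longleftrightarrow>
      (\<exists>n. real n \<le> 33 * (real d)\<^sup>2 * (max 1 (log 2 (1 / eps)) + log 2 (1 / (1 - lam))) \<and>
        (\<forall>f. f \<in> cube d \<rightarrow> cube d \<longrightarrow> contracting p d lam f \<longrightarrow> solves_within p d eps n f A))"
    for d eps lam A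
  \<comment> \<open>The choice is made for each \<open>d\<close>, \<open>eps\<close> and
    \<open>lam\<close> before \<open>f\<close> is given, so one decision tree serves all
    \<open>f\<close>.\<close>
  define A where "A d eps lam = (SOME B. good d eps lam B)" for d eps lam
  have good: "good d eps lam (A d eps lam)" if "0 < eps" "0 \<le> lam" "lam < 1" for d eps lam
    unfolding A_def
  proof (rule someI_ex)
    show "\<exists>B. good d eps lam B"
      unfolding good_def using lp_algorithm[OF assms that] .
  qed
  show ?thesis
  proof (intro exI[of _ A] exI[of _ 33] allI impI)
    fix d :: nat and eps lam :: real and f :: "(nat \<Rightarrow> real) \<Rightarrow> nat \<Rightarrow> real"
    assume *: "0 < eps" "0 \<le> lam" "lam < 1" and f: "f \<in> cube d \<rightarrow> cube d" "contracting p d lam f"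
    obtain n where n: "real n \<le> 33 * (real d)\<^sup>2 * (max 1 (log 2 (1 / eps)) + log 2 (1 / (1 - lam)))"
      and A: "\<forall>f. f \<in> cube d \<rightarrow> cube d \<longrightarrow> contracting p d lam f \<longrightarrow>
        solves_within p d eps n f (A d eps lam)"
      using good[OF *, of d] unfolding good_def by (elim exE conjE) (rule that)
    have "solves_within p d eps n f (A d eps lam)"
      using A f by simp
    with n show "set (queries f (A d eps lam)) \<subseteq> cube d \<and>
        approx_fixpoint p d eps f (result f (A d eps lam)) \<and>
        real (length (queries f (A d eps lam)))
          \<le> 33 * (real d)\<^sup>2 * (max 1 (log 2 (1 / eps)) + log 2 (1 / (1 - lam)))"
      unfolding solves_within_def by (meson of_nat_mono order_trans)
  qed
qed

end
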